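(* Let $m\geq 2$ be an integer, let $n_1=m(m+1)$, $n_2=m(m+1)+1$, $n_3=(m+1)^2$, $n_4=(m+1)^2+1$, let $\mathfrak{S}_m=\langle n_1,n_2,n_3,n_4\rangle$, let $K$ be a field and let $R=K[[t^{n_1},t^{n_2},t^{n_3},t^{n_4}]]$ with maximal ideal $\mathfrak{m}$. Then the tangent cone $G_{\mathfrak{m}}(\mathfrak{S}_m)$ is Cohen–Macaulay.
   Context: The tangent cone is the associated graded ring $G_{\mathfrak{m}}(\mathfrak{S}_m)=\bigoplus_{n\geq 0}\mathfrak{m}^n/\mathfrak{m}^{n+1}$ of $R$. *)

theory Defs
  imports
    "HOL-Algebra.QuotRing"
    "HOL-Algebra.Ideal_Product"
    "HOL-Algebra.Ring_Divisibility"
    "HOL-Library.Extended_Nat"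
    "HOL-Computational_Algebra.Formal_Power_Series"
begin

section \<open>The ring \<open>K[[t\<^sup>n\<^sup>1, \<dots>, t\<^sup>n\<^sup>k]]\<close>\<close>

definition weight :: "nat list \<Rightarrow> nat list \<Rightarrow> nat" where
  "weight ns a = (\<Sum>i<length ns. a ! i * ns ! i)"

definition generated_semigroup :: "nat list \<Rightarrow> nat set" where
  "generated_semigroup ns = {weight ns a | a. length a = length ns}"

text \<open>
  The family \<open>c\<close> of coefficients, indexed by exponent vectors \<open>a\<close> of length \<open>k\<close>, stands for the
  formal power series \<open>\<Sum>a. c a x\<^sup>a\<close> in \<open>k\<close> variables; substituting \<open>t\<^sup>n\<^sup>i\<close> for the \<open>i\<close>-th variable
  is meaningful when all entries of \<open>ns\<close> are positive, since the sums below are then finite.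
\<close>
definition subst_monomials :: "nat list \<Rightarrow> (nat list \<Rightarrow> 'k) \<Rightarrow> 'k::field fps" where
  "subst_monomials ns c = Abs_fps (\<lambda>n. \<Sum>a | length a = length ns \<and> weight ns a = n. c a)"

definition power_series_ring :: "nat list \<Rightarrow> 'k::field fps ring" where
  "power_series_ring ns =
    \<lparr>carrier = range (subst_monomials ns), monoid.mult = (*), one = 1, zero = 0, add = (+)\<rparr>"


section \<open>The associated graded ring of an ideal\<close>

text \<open>
  An element of \<open>\<Oplus>n. I\<^sup>n / I\<^sup>n\<^sup>+\<^sup>1\<close> is a sequence of cosets, almost all of them zero.  The group
  \<open>I\<^sup>n / I\<^sup>n\<^sup>+\<^sup>1\<close> is regarded as a subgroup of \<open>R / I\<^sup>n\<^sup>+\<^sup>1\<close>.  The product of the classes of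
  \<open>x \<in> I\<^sup>i\<close> and \<open>y \<in> I\<^sup>j\<close> is the class of \<open>x y\<close> modulo \<open>I\<^sup>i\<^sup>+\<^sup>j\<^sup>+\<^sup>1\<close>.  Powers of ideals are taken in
  the semiring of ideals, so that \<open>I\<^sup>0\<close> is the whole ring.
\<close>
definition assoc_graded_ring :: "('a, 'b) ring_scheme \<Rightarrow> 'a set \<Rightarrow> (nat \<Rightarrow> 'a set) ring" where
  "assoc_graded_ring R I = (let pow = (\<lambda>n::nat. I [^]\<^bsub>ideals_set R\<^esub> n) in
    \<lparr>carrier = {g. (\<forall>n. \<exists>x\<in>pow n. g n = pow (Suc n) +>\<^bsub>R\<^esub> x) \<and> finite {n. g n \<noteq> pow (Suc n)}},
     monoid.mult = (\<lambda>g h n. finsum (R Quot pow (Suc n))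
                       (\<lambda>i. rcoset_mult R (pow (Suc n)) (g i) (h (n - i))) {..n}),
     one = (\<lambda>n. if n = 0 then pow 1 +>\<^bsub>R\<^esub> \<one>\<^bsub>R\<^esub> else pow (Suc n)),
     zero = (\<lambda>n. pow (Suc n)),
     add = (\<lambda>g h n. g n <+>\<^bsub>R\<^esub> h n)\<rparr>)"


section \<open>Cohen--Macaulay rings\<close>

definition height :: "('a, 'b) ring_scheme \<Rightarrow> 'a set \<Rightarrow> enat" where
  "height R P = Sup {enat n | n. \<exists>Q. Q n = P \<and> (\<forall>i\<le>n. primeideal (Q i) R) \<and>
                                     (\<forall>i<n. Q i \<subset> Q (Suc i))}"

text \<open>Each element is a nonzerodivisor modulo its predecessors, and the quotient by the whole
  sequence is not the zero ring.\<close>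
definition regular_sequence :: "('a, 'b) ring_scheme \<Rightarrow> 'a list \<Rightarrow> bool" where
  "regular_sequence R xs \<longleftrightarrow>
     set xs \<subseteq> carrier R \<and>
     (\<forall>i<length xs. \<forall>a\<in>carrier R.
        xs ! i \<otimes>\<^bsub>R\<^esub> a \<in> genideal R (set (take i xs)) \<longrightarrow> a \<in> genideal R (set (take i xs))) \<and>
     genideal R (set xs) \<noteq> carrier R"

definition depth :: "('a, 'b) ring_scheme \<Rightarrow> 'a set \<Rightarrow> enat" where
  "depth R I = Sup {enat (length xs) | xs. set xs \<subseteq> I \<and> regular_sequence R xs}"

text \<open>
  The definition in Eisenbud, \<^emph>\<open>Commutative Algebra\<close>, Section 18.2, for Noetherian rings that
  need not be local.
\<close>
definition cohen_macaulay :: "('a, 'b) ring_scheme \<Rightarrow> bool" where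
  "cohen_macaulay R \<longleftrightarrow>
     cring R \<and> noetherian_ring R \<and> (\<forall>P. maximalideal P R \<longrightarrow> depth R P = height R P)"


section \<open>Sanity checks\<close>

lemma finite_weight_fibre:
  assumes "\<forall>k\<in>set ns. 0 < k"
  shows "finite {a. length a = length ns \<and> weight ns a = n}"
proof (rule finite_subset)
  show "finite {a. set a \<subseteq> {..n} \<and> length a = length ns}"
    by (rule finite_lists_length_eq) simp
  show "{a. length a = length ns \<and> weight ns a = n} \<subseteq> {a. set a \<subseteq> {..n} \<and> length a = length ns}"
  proof clarsimp
    fix a x assume len: "length a = length ns" and n: "n = weight ns a" and "x \<in> set a"
    then obtain i where i: "i < length ns" "x = a ! i" by (metis in_set_conv_nth)
    have "a ! i * 1 \<le> a ! i * ns ! i"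
      using assms i by (intro mult_le_mono) (auto simp: Suc_le_eq)
    also have "\<dots> \<le> weight ns a"
      unfolding weight_def using i by (intro member_le_sum) auto
    finally show "x \<le> weight ns a" using i by simp
  qed
qed

lemma carrier_power_series_ring:
  assumes "\<forall>k\<in>set ns. 0 < k"
  shows "carrier (power_series_ring ns) =
    {f :: 'k::field fps. \<forall>n. fps_nth f n \<noteq> 0 \<longrightarrow> n \<in> generated_semigroup ns}"
proof (intro equalityI subsetI CollectI allI impI)
  fix f :: "'k fps" and n
  assume "f \<in> carrier (power_series_ring ns)" and nz: "fps_nth f n \<noteq> 0"
  then obtain c where "f = subst_monomials ns c" by (auto simp: power_series_ring_def)
  with nz have "(\<Sum>a | length a = length ns \<and> weight ns a = n. c a) \<noteq> 0"
    by (simp add: subst_monomials_def)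
  then have "{a. length a = length ns \<and> weight ns a = n} \<noteq> {}" by (metis sum.empty)
  then show "n \<in> generated_semigroup ns" by (auto simp: generated_semigroup_def)
next
  fix f :: "'k fps"
  assume "f \<in> {f. \<forall>n. fps_nth f n \<noteq> 0 \<longrightarrow> n \<in> generated_semigroup ns}"
  then have supp: "\<exists>a. length a = length ns \<and> weight ns a = n" if "fps_nth f n \<noteq> 0" for n
    using that by (auto simp: generated_semigroup_def)
  define e where "e n = (SOME a. length a = length ns \<and> weight ns a = n)" for n
  have e: "length (e n) = length ns \<and> weight ns (e n) = n" if "fps_nth f n \<noteq> 0" for n
    unfolding e_def using supp[OF that] by (rule someI_ex)
  define c where "c a = (if a = e (weight ns a) then fps_nth f (weight ns a) else 0)" for a
  have "f = subst_monomials ns c"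
  proof (rule fps_ext)
    fix n
    let ?A = "{a. length a = length ns \<and> weight ns a = n}"
    have "fps_nth (subst_monomials ns c) n = (\<Sum>a\<in>?A. if a = e n then fps_nth f n else 0)"
      unfolding subst_monomials_def by (auto simp: c_def intro!: sum.cong)
    also have "\<dots> = fps_nth f n"
      using finite_weight_fibre[OF assms, of n] e[of n] by (auto simp: sum.delta)
    finally show "fps_nth f n = fps_nth (subst_monomials ns c) n" by simp
  qed
  then show "f \<in> carrier (power_series_ring ns)" by (auto simp: power_series_ring_def)
qed

lemma zero_in_generated_semigroup: "0 \<in> generated_semigroup ns"
  unfolding generated_semigroup_def weight_def
  by (rule CollectI, rule exI[of _ "replicate (length ns) 0"]) simp

lemma add_in_generated_semigroup:
  assumes "p \<in> generated_semigroup ns" "q \<in> generated_semigroup ns"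
  shows "p + q \<in> generated_semigroup ns"
proof -
  obtain a b where "length a = length ns" "length b = length ns" "p = weight ns a" "q = weight ns b"
    using assms by (auto simp: generated_semigroup_def)
  then have "p + q = weight ns (map2 (+) a b)" "length (map2 (+) a b) = length ns"
    by (auto simp: weight_def sum.distrib[symmetric] algebra_simps)
  then show ?thesis unfolding generated_semigroup_def by blast
qed

lemma cring_power_series_ring:
  assumes "\<forall>k\<in>set ns. 0 < k"
  shows "cring (power_series_ring ns :: 'k::field fps ring)"
proof -
  let ?R = "power_series_ring ns :: 'k fps ring"
  note C = carrier_power_series_ring[OF assms, where ?'k = 'k]
  have ops: "monoid.mult ?R = (*)" "one ?R = 1" "zero ?R = 0" "add ?R = (+)"
    by (simp_all add: power_series_ring_def)
  have times: "f * g \<in> carrier ?R" if "f \<in> carrier ?R" "g \<in> carrier ?R" for f g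
    unfolding C
  proof (intro CollectI allI impI)
    fix n assume "fps_nth (f * g) n \<noteq> 0"
    then have "(\<Sum>i=0..n. fps_nth f i * fps_nth g (n - i)) \<noteq> 0" by (simp add: fps_mult_nth)
    then obtain i where "i \<in> {0..n}" "fps_nth f i * fps_nth g (n - i) \<noteq> 0"
      by (meson sum.neutral)
    then have "i \<le> n" "i \<in> generated_semigroup ns" "n - i \<in> generated_semigroup ns"
      using that unfolding C by auto
    then show "n \<in> generated_semigroup ns" using add_in_generated_semigroup[of i ns "n - i"] by simp
  qed
  have plus: "f + g \<in> carrier ?R" if "f \<in> carrier ?R" "g \<in> carrier ?R" for f g
    using that unfolding C by (auto; metis add.right_neutral)
  have one: "1 \<in> carrier ?R"
    unfolding C by (auto simp: zero_in_generated_semigroup fps_one_nth)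
  show ?thesis
  proof (rule cringI)
    show "abelian_group ?R"
    proof (rule abelian_groupI, unfold ops)
      show "\<exists>g\<in>carrier ?R. g + f = 0" if "f \<in> carrier ?R" for f
        using that by (intro bexI[of _ "- f"]) (auto simp: C)
      show "0 \<in> carrier ?R" by (simp add: C)
    qed (auto simp: plus add.assoc add.commute)
    show "comm_monoid ?R"
      by (rule comm_monoidI, unfold ops)
        (auto simp: times one mult.assoc mult.commute)
  qed (auto simp: ops distrib_right)
qed

lemma inverse_in_power_series_ring:
  assumes "\<forall>k\<in>set ns. 0 < k" "f \<in> carrier (power_series_ring ns)" "fps_nth f 0 \<noteq> 0"
  shows "inverse (f :: 'k::field fps) \<in> carrier (power_series_ring ns)"
proof -
  note C = carrier_power_series_ring[OF assms(1), where ?'k = 'k]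
  have "fps_nth (inverse f) n \<noteq> 0 \<Longrightarrow> n \<in> generated_semigroup ns" for n
  proof (induction n rule: less_induct)
    case (less n)
    show ?case
    proof (cases "n = 0")
      case True then show ?thesis by (simp add: zero_in_generated_semigroup)
    next
      case False
      have "fps_nth (f * inverse f) n = 0"
        using False assms(3) by (simp add: inverse_mult_eq_1' fps_one_nth)
      then have "(\<Sum>i=0..n. fps_nth f i * fps_nth (inverse f) (n - i)) = 0"
        by (simp add: fps_mult_nth)
      then have "fps_nth f 0 * fps_nth (inverse f) n
          + (\<Sum>i=Suc 0..n. fps_nth f i * fps_nth (inverse f) (n - i)) = 0"
        by (simp add: sum.atLeast_Suc_atMost)
      then have "(\<Sum>i=Suc 0..n. fps_nth f i * fps_nth (inverse f) (n - i)) \<noteq> 0"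
        using less.prems assms(3) by auto
      then obtain i where i: "i \<in> {Suc 0..n}" "fps_nth f i * fps_nth (inverse f) (n - i) \<noteq> 0"
        by (meson sum.neutral)
      then have "i \<in> generated_semigroup ns" "n - i \<in> generated_semigroup ns"
        using less.IH[of "n - i"] assms(2) unfolding C by auto
      then show ?thesis using add_in_generated_semigroup[of i ns "n - i"] i by simp
    qed
  qed
  then show ?thesis by (simp add: C)
qed

text \<open>The ring is local, and its maximal ideal consists of the series without constant term.\<close>
lemma maximalideal_power_series_ring_iff:
  assumes "\<forall>k\<in>set ns. 0 < k"
  shows "maximalideal M (power_series_ring ns :: 'k::field fps ring) \<longleftrightarrow>
    M = {f \<in> carrier (power_series_ring ns). fps_nth f 0 = 0}"
proof -
  let ?R = "power_series_ring ns :: 'k fps ring"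
  let ?M = "{f \<in> carrier ?R. fps_nth f 0 = 0}"
  interpret cring ?R using assms by (rule cring_power_series_ring)
  have ops: "monoid.mult ?R = (*)" "one ?R = 1" "zero ?R = 0" "add ?R = (+)"
    by (simp_all add: power_series_ring_def)
  have proper: "J \<subseteq> ?M" if J: "ideal J ?R" "J \<noteq> carrier ?R" for J
  proof (rule ccontr)
    assume "\<not> J \<subseteq> ?M"
    then obtain f where f: "f \<in> J" "f \<in> carrier ?R" "fps_nth f 0 \<noteq> 0"
      using ideal.Icarr[OF J(1)] by auto
    have "f * inverse f \<in> J"
      using ideal.I_r_closed[OF J(1) f(1) inverse_in_power_series_ring[OF assms f(2,3)]]
      by (simp add: ops)
    then have "\<one>\<^bsub>?R\<^esub> \<in> J" using f(3) by (simp add: inverse_mult_eq_1' ops)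
    then show False using ideal.one_imp_carrier[OF J(1)] J(2) by simp
  qed
  have inv: "\<ominus>\<^bsub>?R\<^esub> f = - f" if "f \<in> carrier ?R" for f
    using r_neg[OF that] by (simp add: ops eq_neg_iff_add_eq_0 add.commute)
  have M: "ideal ?M ?R"
  proof (rule idealI)
    show "ring ?R" by (rule ring_axioms)
    show "subgroup ?M (add_monoid ?R)"
    proof (rule add.subgroupI)
      show "?M \<noteq> {}" using zero_closed by (auto simp: ops intro!: exI[of _ 0])
      show "\<ominus>\<^bsub>?R\<^esub> f \<in> ?M" if "f \<in> ?M" for f
        using that inv[of f] a_inv_closed[of f] by simp
    qed (use a_closed in \<open>auto simp: ops\<close>)
  qed (use m_closed in \<open>auto simp: ops\<close>)
  have "1 \<in> carrier ?R" "1 \<notin> ?M" using one_closed by (auto simp: ops)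
  then have neq: "?M \<noteq> carrier ?R" by blast
  show ?thesis
  proof
    assume "maximalideal M ?R"
    then interpret maximalideal M ?R .
    show "M = ?M"
      using I_maximal[OF M] proper[OF is_ideal] I_notcarr neq by auto
  next
    assume "M = ?M"
    moreover have "maximalideal ?M ?R"
      by (rule maximalidealI[OF M]) (use neq proper in auto)
    ultimately show "maximalideal M ?R" by simp
  qed
qed

end

theory Submission
  imports Defs "HOL-Computational_Algebra.Polynomial"
begin

text \<open>
  For \<open>s \<in> S\<close> let \<open>ord s\<close> be the largest number of generators with sum \<open>s\<close>.  The power \<open>M\<^sup>n\<close>
  consists of the series supported on \<open>{s \<in> S. ord s \<ge> n}\<close>, so that the tangent cone has a basis
  indexed by \<open>S\<close>.  With \<open>q = m + 1\<close> and \<open>e = q (q - 1)\<close> the generators are \<open>e + {0, 1} + {0, q}\<close>;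
  the sums of \<open>k\<close> generators are thus the numbers \<open>k e + x + y q\<close> with \<open>x, y \<le> k\<close>, from which one
  reads off \<open>ord (s + e) = ord s + 1\<close>.  This says that the class of \<open>t\<^sup>e\<close> is a nonzerodivisor, and
  the tangent cone is a finite free module over \<open>K[t\<^sup>e]\<close>.  Since \<open>e * ord s < s\<close> unless \<open>e\<close> divides
  \<open>s\<close>, the basis elements outside \<open>K[t\<^sup>e]\<close> span a nilpotent ideal with quotient \<open>K[t\<^sup>e]\<close>, and every
  element outside this ideal is a nonzerodivisor.  Hence the maximal ideals correspond to those of
  a polynomial ring in one variable, and both their height and their depth are one.
\<close>



section \<open>Rings that are a polynomial ring modulo nilpotents\<close>

lemma (in primeideal) pow_mem_imp_mem:
  assumes "a \<in> carrier R" "a [^] (k::nat) \<in> I"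
  shows "a \<in> I"
  using assms(2)
proof (induction k)
  case 0
  then show ?case using I_notcarr one_imp_carrier by simp
next
  case (Suc k)
  then show ?case using I_prime[of "a [^] k" a] assms(1) by auto
qed

text \<open>Each division by the nonunit \<open>f\<close> lowers the degree of \<open>g\<close>, so
  it can be repeated only finitely often.\<close>

lemma poly_power_factor:
  fixes f g :: "'k::field poly"
  assumes "\<not> is_unit f" "g \<noteq> 0"
  shows "\<exists>e h. g = f ^ e * h \<and> \<not> f dvd h"
  using assms(2)
proof (induction "degree g" arbitrary: g rule: less_induct)
  case less
  show ?case
  proof (cases "f dvd g")
    case True
    then obtain h where h: "g = f * h" by (rule dvdE)
    with less.prems have "f \<noteq> 0" "h \<noteq> 0" by auto
    then have "degree h < degree g"
      using assms(1) by (simp add: h degree_mult_eq is_unit_iff_degree)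
    then obtain e h' where "h = f ^ e * h'" "\<not> f dvd h'" using less.hyps \<open>h \<noteq> 0\<close> by blast
    then have "g = f ^ Suc e * h'" by (simp add: h mult.assoc)
    then show ?thesis using \<open>\<not> f dvd h'\<close> by blast
  next
    case False
    then have "g = f ^ 0 * g \<and> \<not> f dvd g" by simp
    then show ?thesis by blast
  qed
qed

lemma (in ring) Idl_empty: "Idl {} = {\<zero>}"
  using genideal_minimal[OF zeroideal, of "{}"] additive_subgroup.zero_closed[OF ideal.axioms(1)]
    genideal_ideal[of "{}"] by blast

text \<open>The kernel of \<open>\<pi>\<close> is a nil ideal with quotient K[X], and every zero
  divisor lies in it. Height and depth of the maximal ideals can then be read off from the principal
  ideal domain K[X].\<close>

locale poly_mod_nilpotents = cring A for A (structure) +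
  fixes \<pi> :: "'a \<Rightarrow> 'k::field poly"
  assumes proj_add: "\<lbrakk>a \<in> carrier A; b \<in> carrier A\<rbrakk> \<Longrightarrow> \<pi> (a \<oplus> b) = \<pi> a + \<pi> b"
    and proj_mult: "\<lbrakk>a \<in> carrier A; b \<in> carrier A\<rbrakk> \<Longrightarrow> \<pi> (a \<otimes> b) = \<pi> a * \<pi> b"
    and proj_one: "\<pi> \<one> = 1"
    and proj_surj: "\<exists>a\<in>carrier A. \<pi> a = f"
    and nilpotent: "\<lbrakk>a \<in> carrier A; \<pi> a = 0\<rbrakk> \<Longrightarrow> \<exists>k::nat. a [^] k = \<zero>"
    and regular: "\<lbrakk>a \<in> carrier A; b \<in> carrier A; \<pi> a \<noteq> 0; a \<otimes> b = \<zero>\<rbrakk> \<Longrightarrow> b = \<zero>"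
begin

lemma proj_zero: "\<pi> \<zero> = 0"
proof -
  have "\<pi> \<zero> + \<pi> \<zero> = \<pi> \<zero>" using proj_add[of \<zero> \<zero>] by simp
  then show ?thesis by (metis add_cancel_left_left)
qed

lemma proj_minus:
  assumes "a \<in> carrier A" "b \<in> carrier A"
  shows "\<pi> (a \<ominus> b) = \<pi> a - \<pi> b"
proof -
  have "(a \<ominus> b) \<oplus> b = a" using assms by algebra
  then have "\<pi> (a \<ominus> b) + \<pi> b = \<pi> a" using proj_add[of "a \<ominus> b" b] assms by simp
  then show ?thesis by (simp add: algebra_simps)
qed

lemma proj_pow: "a \<in> carrier A \<Longrightarrow> \<pi> (a [^] (k::nat)) = \<pi> a ^ k"
  by (induction k) (simp_all add: proj_one proj_mult mult.commute)

text \<open>The difference \<open>x \<ominus> y\<close> lies in the kernel and is nilpotent. Modulo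
  \<open>I\<close> the element \<open>y\<close> vanishes, so \<open>x\<close> and
  \<open>x \<ominus> y\<close> have the same powers there.\<close>

lemma proj_eq_imp_pow_mem:
  assumes "ideal I A" "x \<in> carrier A" "y \<in> I" "\<pi> x = \<pi> y"
  shows "\<exists>k::nat. x [^] k \<in> I"
proof -
  interpret I: ideal I A by fact
  have y: "y \<in> carrier A" using assms(3) by (rule I.Icarr)
  have diff: "x [^] j \<ominus> (x \<ominus> y) [^] j \<in> I" for j :: nat
  proof (induction j)
    case 0
    then show ?case using I.zero_closed by (simp add: r_neg minus_eq)
  next
    case (Suc j)
    have "x [^] Suc j \<ominus> (x \<ominus> y) [^] Suc j
        = (x [^] j \<ominus> (x \<ominus> y) [^] j) \<otimes> x \<oplus> (x \<ominus> y) [^] j \<otimes> y"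
    proof -
      have "x [^] j \<in> carrier A" "(x \<ominus> y) [^] j \<in> carrier A"
        using assms(2) y by simp_all
      then show ?thesis using assms(2) y unfolding nat_pow_Suc by algebra
    qed
    moreover have "(x [^] j \<ominus> (x \<ominus> y) [^] j) \<otimes> x \<in> I"
      using Suc assms(2) by (rule I.I_r_closed)
    moreover have "(x \<ominus> y) [^] j \<otimes> y \<in> I"
      using assms(2,3) y by (intro I.I_l_closed) simp_all
    ultimately show ?case by (simp add: I.a_closed)
  qed
  obtain k :: nat where "(x \<ominus> y) [^] k = \<zero>"
    using nilpotent[of "x \<ominus> y"] proj_minus[of x y] assms(2,4) y by auto
  then have "x [^] k \<in> I" using diff[of k] assms(2) by (simp add: minus_eq)
  then show ?thesis ..
qed

lemma primeideal_proj_mem: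
  assumes "primeideal Q A" "x \<in> carrier A" "y \<in> Q" "\<pi> x = \<pi> y"
  shows "x \<in> Q"
proof -
  interpret Q: primeideal Q A by fact
  show ?thesis
    using proj_eq_imp_pow_mem[OF Q.is_ideal assms(2-4)] Q.pow_mem_imp_mem[OF assms(2)] by blast
qed

lemma primeideal_kernel_subset:
  assumes "primeideal Q A" "x \<in> carrier A" "\<pi> x = 0"
  shows "x \<in> Q"
proof -
  interpret Q: primeideal Q A by fact
  show ?thesis
    using primeideal_proj_mem[OF assms(1,2) Q.zero_closed] assms(3) by (simp add: proj_zero)
qed

section \<open>Prime ideals as preimages of ideals of the polynomial ring\<close>

text \<open>The image of \<open>I\<close> is an ideal of K[X]; an element of least degree among its
  nonzero members generates it, by division with remainder. The element \<open>u\<close> is a lift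
  of this generator inside \<open>I\<close>.\<close>

lemma ideal_proj_generator:
  assumes "ideal I A"
  shows "\<exists>u\<in>I. \<forall>a\<in>I. \<pi> u dvd \<pi> a"
proof (cases "\<forall>a\<in>I. \<pi> a = 0")
  case True
  interpret I: ideal I A by fact
  have "\<forall>a\<in>I. \<pi> \<zero> dvd \<pi> a" using True by (simp add: proj_zero)
  then show ?thesis using I.zero_closed by blast
next
  case False
  interpret I: ideal I A by fact
  from False obtain u0 where "u0 \<in> I \<and> \<pi> u0 \<noteq> 0" by blast
  from ex_has_least_nat[of "\<lambda>u. u \<in> I \<and> \<pi> u \<noteq> 0", OF this, of "\<lambda>u. degree (\<pi> u)"]
  obtain u where u: "u \<in> I" "\<pi> u \<noteq> 0"
    and min: "\<And>v. v \<in> I \<Longrightarrow> \<pi> v \<noteq> 0 \<Longrightarrow> degree (\<pi> u) \<le> degree (\<pi> v)"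
    by (elim exE) blast
  have "\<pi> u dvd \<pi> a" if a: "a \<in> I" for a
  proof (rule ccontr)
    assume "\<not> \<pi> u dvd \<pi> a"
    then have nz: "\<pi> a mod \<pi> u \<noteq> 0" by (simp add: dvd_eq_mod_eq_0)
    obtain w where w: "w \<in> carrier A" "\<pi> w = \<pi> a div \<pi> u" using proj_surj by blast
    have carr: "a \<in> carrier A" "u \<in> carrier A" using a u by (simp_all add: I.Icarr)
    have "w \<otimes> u \<in> I" using u w by (simp add: I.I_l_closed)
    then have "a \<ominus> w \<otimes> u \<in> I" using a by (simp add: minus_eq)
    moreover have "\<pi> (a \<ominus> w \<otimes> u) = \<pi> a mod \<pi> u"
      using carr w by (simp add: proj_minus proj_mult minus_div_mult_eq_mod)
    ultimately have "degree (\<pi> u) \<le> degree (\<pi> a mod \<pi> u)" using min nz by metis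
    then show False using degree_mod_less[OF u(2), of "\<pi> a"] nz by linarith
  qed
  then show ?thesis using u(1) by blast
qed

text \<open>A prime ideal is saturated for \<open>\<pi>\<close> by
  \<open>primeideal_proj_mem\<close>, hence the full preimage of the principal ideal generated by
  \<open>\<pi> u\<close>.\<close>

lemma primeideal_mem_iff:
  assumes "primeideal Q A" "u \<in> Q" "\<forall>a\<in>Q. \<pi> u dvd \<pi> a" "a \<in> carrier A"
  shows "a \<in> Q \<longleftrightarrow> \<pi> u dvd \<pi> a"
proof
  interpret Q: primeideal Q A by fact
  assume "\<pi> u dvd \<pi> a"
  then obtain f where "\<pi> a = \<pi> u * f" by (rule dvdE)
  moreover obtain w where w: "w \<in> carrier A" "\<pi> w = f" using proj_surj by blast
  ultimately have "\<pi> a = \<pi> (u \<otimes> w)" using assms(2) by (simp add: proj_mult Q.Icarr)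
  moreover have "u \<otimes> w \<in> Q" using assms(2) w by (simp add: Q.I_r_closed)
  ultimately show "a \<in> Q" using primeideal_proj_mem[OF assms(1,4)] by blast
qed (use assms(3) in blast)

text \<open>This reflects that K[X] has dimension one. The generator of the smaller ideal factors as
  \<open>\<pi> u = \<pi> u' * f\<close>; as \<open>u'\<close> is not in \<open>Q\<close>, primality
  puts a lift of \<open>f\<close> into \<open>Q\<close>, so \<open>\<pi> u\<close> divides its own
  factor \<open>f\<close>.\<close>

lemma primeideal_psubset_imp_kernel:
  assumes "primeideal Q A" "primeideal Q' A" "Q \<subset> Q'" "a \<in> Q"
  shows "\<pi> a = 0"
proof -
  interpret Q: primeideal Q A by fact
  interpret Q': primeideal Q' A by fact
  obtain u where u: "u \<in> Q" "\<forall>a\<in>Q. \<pi> u dvd \<pi> a"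
    using ideal_proj_generator[OF Q.is_ideal] by blast
  obtain u' where u': "u' \<in> Q'" "\<forall>a\<in>Q'. \<pi> u' dvd \<pi> a"
    using ideal_proj_generator[OF Q'.is_ideal] by blast
  note mem = primeideal_mem_iff[OF assms(1) u]
  note mem' = primeideal_mem_iff[OF assms(2) u']
  have carr: "u' \<in> carrier A" using u' Q'.Icarr by blast
  have "\<pi> u' dvd \<pi> u" using u u' assms(3) by blast
  then obtain f where f: "\<pi> u = \<pi> u' * f" by (rule dvdE)
  obtain w where w: "w \<in> carrier A" "\<pi> w = f" using proj_surj by blast
  have "u' \<otimes> w \<in> Q" using mem[of "u' \<otimes> w"] carr w f by (simp add: proj_mult)
  moreover have "u' \<notin> Q"
  proof
    assume "u' \<in> Q"
    then have "\<pi> u dvd \<pi> u'" using u(2) by blast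
    then have "a \<in> Q" if "a \<in> Q'" for a
      using that u'(2) mem[of a] dvd_trans[of "\<pi> u" "\<pi> u'" "\<pi> a"] Q'.Icarr by blast
    then have "Q' \<subseteq> Q" by blast
    then show False using assms(3) by blast
  qed
  ultimately have "w \<in> Q" using Q.I_prime carr w by blast
  then have "\<pi> u dvd f" using u w by blast
  \<comment> \<open>If \<open>\<pi> u\<close> were nonzero, it could be cancelled, making
    \<open>\<pi> u'\<close> a unit and \<open>Q'\<close> the whole ring.\<close>
  moreover have "\<pi> u = 0" if "\<pi> u dvd f"
  proof (rule ccontr)
    assume nz: "\<pi> u \<noteq> 0"
    obtain h where "f = \<pi> u * h" using \<open>\<pi> u dvd f\<close> by (rule dvdE)
    then have "\<pi> u * (\<pi> u' * h) = \<pi> u' * f" by (simp add: mult.left_commute)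
    also have "\<dots> = \<pi> u * 1" by (simp add: f)
    finally have "\<pi> u * (\<pi> u' * h) = \<pi> u * 1" .
    then have "\<pi> u' * h = 1" using nz mult_left_cancel by blast
    then have "\<pi> u' dvd 1" using dvd_triv_left[of "\<pi> u'" h] by simp
    then have "\<one> \<in> Q'" using mem'[of \<one>] by (simp add: proj_one)
    then show False using Q'.I_notcarr Q'.one_imp_carrier by simp
  qed
  ultimately show ?thesis using u(2) assms(4) by auto
qed

text \<open>The preimage of a principal ideal. The case \<open>d = 0\<close> is the kernel, and
  \<open>d = X\<close> gives a proper ideal strictly above it.\<close>

lemma ideal_proj_dvd: "ideal {a \<in> carrier A. d dvd \<pi> a} A" (is "ideal ?J A")
proof (rule idealI)
  show "ring A" by (rule ring_axioms)
  show "subgroup ?J (add_monoid A)"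
  proof (rule add.subgroupI)
    have "\<zero> \<in> ?J" by (simp add: proj_zero)
    then show "?J \<noteq> {}" by blast
    fix a assume a: "a \<in> ?J"
    then have "\<pi> (\<ominus> a) = - \<pi> a" using proj_minus[of \<zero> a] by (simp add: minus_eq proj_zero)
    then show "\<ominus> a \<in> ?J" using a by simp
  qed (auto simp: proj_add)
qed (auto simp: proj_mult)

lemma primeideal_kernel: "primeideal {a \<in> carrier A. \<pi> a = 0} A" (is "primeideal ?N A")
proof (rule primeidealI)
  show "ideal ?N A" using ideal_proj_dvd[of 0] by simp
  show "carrier A \<noteq> ?N" using proj_one one_closed by force
qed (auto simp: proj_mult cring_axioms)

lemma maximalideal_not_kernel:
  assumes "maximalideal P A"
  shows "P \<noteq> {a \<in> carrier A. \<pi> a = 0}"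
proof
  assume P: "P = {a \<in> carrier A. \<pi> a = 0}"
  \<comment> \<open>The variable X, as a nonzero nonunit of the polynomial ring.\<close>
  define d :: "'k poly" where "d = monom 1 1"
  have d: "d \<noteq> 0" "\<not> d dvd 1"
    unfolding d_def by (simp_all add: is_unit_iff_degree degree_monom_eq)
  let ?J = "{a \<in> carrier A. d dvd \<pi> a}"
  obtain x where x: "x \<in> carrier A" "\<pi> x = d" using proj_surj by blast
  have "P \<subseteq> ?J" unfolding P by (intro subsetI CollectI) simp
  then have "?J = P \<or> ?J = carrier A"
    using maximalideal.I_maximal[OF assms ideal_proj_dvd] by blast
  moreover have "x \<in> ?J" using x by simp
  moreover have "x \<notin> P" unfolding P using x d by simp
  moreover have "\<one> \<notin> ?J" using d(2) by (simp add: proj_one)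
  ultimately show False using one_closed by blast
qed

section \<open>Height and depth of the maximal ideals\<close>

text \<open>The kernel below \<open>P\<close> is a chain of length one. In a chain of length two the
  middle prime would lie in the kernel, which the bottom prime contains.\<close>

lemma height_maximalideal:
  assumes "maximalideal P A"
  shows "height A P = 1"
proof -
  let ?N = "{a \<in> carrier A. \<pi> a = 0}"
  have P: "primeideal P A" using maximalideal_prime[OF assms] .
  have "?N \<subset> P"
    using primeideal_kernel_subset[OF P] maximalideal_not_kernel[OF assms] by auto
  then have "enat 1 \<in> {enat n | n. \<exists>Q. Q n = P \<and> (\<forall>i\<le>n. primeideal (Q i) A) \<and>
                                     (\<forall>i<n. Q i \<subset> Q (Suc i))}"
    using P primeideal_kernel
    by (intro CollectI exI[of _ 1] conjI exI[of _ "\<lambda>i::nat. if i = 0 then ?N else P"]) auto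
  then have "1 \<le> height A P" unfolding height_def by (intro Sup_upper) (simp add: one_enat_def)
  moreover have "height A P \<le> 1"
    unfolding height_def
  proof (rule Sup_least, clarify)
    fix n Q assume Q: "\<forall>i\<le>n. primeideal (Q i) A" "\<forall>i<n. Q i \<subset> Q (Suc i)"
    show "enat n \<le> 1"
    proof (rule ccontr)
      assume "\<not> enat n \<le> 1"
      then have n: "2 \<le> n" by (simp add: one_enat_def)
      then have pr: "primeideal (Q 0) A" "primeideal (Q 1) A" "primeideal (Q 2) A"
        and lt: "Q 0 \<subset> Q 1" "Q 1 \<subset> Q 2"
        using Q by (auto simp: numeral_2_eq_2)
      interpret Q1: primeideal "Q 1" A by fact
      have "Q 1 \<subseteq> Q 0"
        using primeideal_psubset_imp_kernel[OF pr(2,3) lt(2)] primeideal_kernel_subset[OF pr(1)]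
          Q1.Icarr by blast
      then show False using lt by blast
    qed
  qed
  ultimately show ?thesis by (rule antisym[rotated])
qed

text \<open>Cancels one factor \<open>b\<close> at a time. It is applied with \<open>I\<close> the
  zero ideal and with \<open>I\<close> generated by the first member of a regular sequence.\<close>

lemma regular_pow:
  assumes "I \<subseteq> carrier A" "b \<in> carrier A" "\<And>c. c \<in> carrier A \<Longrightarrow> b \<otimes> c \<in> I \<Longrightarrow> c \<in> I"
    "c \<in> carrier A" "b [^] (k::nat) \<otimes> c \<in> I"
  shows "c \<in> I"
  using assms(4,5)
proof (induction k arbitrary: c)
  case (Suc k)
  have "b [^] k \<otimes> (b \<otimes> c) \<in> I" using Suc.prems assms(2) by (simp add: m_assoc)
  then have "b \<otimes> c \<in> I" using Suc.IH[of "b \<otimes> c"] Suc.prems(1) assms(2) by simp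
  then show ?case using assms(3) Suc.prems(1) by blast
qed simp

text \<open>
  If \<open>a\<close>, \<open>b\<close> were a regular sequence in the prime ideal \<open>P\<close>, then a lift \<open>u\<close> of the generator of
  \<open>\<pi> P\<close> would be regular modulo \<open>a\<close>.  Writing \<open>\<pi> a = (\<pi> u)\<^sup>e h\<close> with \<open>e\<close> maximal, a power of a
  lift of \<open>h\<close> lies in \<open>(a) \<subseteq> P\<close>, so that \<open>\<pi> u\<close> divides \<open>h\<close>.
\<close>
lemma regular_sequence_length_le:
  assumes "primeideal P A" "set xs \<subseteq> P" "regular_sequence A xs"
  shows "length xs \<le> 1"
proof (rule ccontr)
  interpret P: primeideal P A by fact
  assume "\<not> length xs \<le> 1"
  then obtain a b ys where xs: "xs = a # b # ys"
    by (cases xs; cases "tl xs") auto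
  have aP: "a \<in> P" and bP: "b \<in> P" using assms(2) xs by auto
  then have a: "a \<in> carrier A" and b: "b \<in> carrier A" by (simp_all add: P.Icarr)
  let ?I = "Idl {a}"
  have I: "ideal ?I A" using a by (intro genideal_ideal) simp
  interpret I: ideal ?I A by (rule I)
  have aI: "a \<in> ?I" using a by (intro genideal_self') simp
  have IP: "?I \<subseteq> P" using aP by (intro genideal_minimal P.is_ideal) simp
  have reg: "\<forall>i<length xs. \<forall>c\<in>carrier A.
      xs ! i \<otimes> c \<in> Idl (set (take i xs)) \<longrightarrow> c \<in> Idl (set (take i xs))"
    using assms(3) by (auto simp: regular_sequence_def)
  have "c = \<zero>" if "c \<in> carrier A" "a \<otimes> c = \<zero>" for c
    using reg[rule_format, of 0 c] that by (simp add: xs Idl_empty)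
  then have reg0: "c \<in> {\<zero>}" if "c \<in> carrier A" "a \<otimes> c \<in> {\<zero>}" for c
    using that by simp
  have reg1: "c \<in> ?I" if "c \<in> carrier A" "b \<otimes> c \<in> ?I" for c
    using reg[rule_format, of 1 c] that by (simp add: xs)
  have "\<one> \<notin> P" using P.I_notcarr P.one_imp_carrier by auto
  then have one_neq: "\<one> \<noteq> \<zero>" using P.zero_closed by auto
  \<comment> \<open>A nonzerodivisor of a nonzero ring is not nilpotent.\<close>
  have pa: "\<pi> a \<noteq> 0"
  proof
    assume "\<pi> a = 0"
    then obtain k :: nat where "a [^] k = \<zero>" using nilpotent a by blast
    then have "\<one> \<in> {\<zero>}" using regular_pow[OF _ a reg0, of \<one> k] a by simp
    then show False using one_neq by simp
  qed
  obtain u where u: "u \<in> P" "\<forall>a\<in>P. \<pi> u dvd \<pi> a"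
    using ideal_proj_generator[OF P.is_ideal] by blast
  note mem = primeideal_mem_iff[OF assms(1) u]
  have ucarr: "u \<in> carrier A" using u P.Icarr by blast
  \<comment> \<open>As \<open>\<pi> u\<close> divides \<open>\<pi> b\<close>, some power of
    \<open>b\<close> is a multiple of \<open>u\<close>. Regularity of \<open>b\<close> modulo
    \<open>a\<close> passes to this power, and from there to its factor \<open>u\<close>.\<close>
  have regu: "c \<in> ?I" if c: "c \<in> carrier A" "u \<otimes> c \<in> ?I" for c
  proof -
    have U: "ideal (PIdl u) A" using ucarr by (rule cgenideal_ideal)
    obtain f where "\<pi> b = \<pi> u * f" using u bP by (meson dvdE)
    moreover obtain w where w: "w \<in> carrier A" "\<pi> w = f" using proj_surj by blast
    ultimately have "\<pi> b = \<pi> (w \<otimes> u)" using ucarr by (simp add: proj_mult)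
    moreover have "w \<otimes> u \<in> PIdl u" using w by (auto simp: cgenideal_def)
    ultimately obtain k :: nat where "b [^] k \<in> PIdl u"
      using proj_eq_imp_pow_mem[OF U b] by blast
    then obtain v where v: "v \<in> carrier A" "b [^] k = v \<otimes> u" by (auto simp: cgenideal_def)
    then have "b [^] k \<otimes> c = v \<otimes> (u \<otimes> c)" using c ucarr by (simp add: m_assoc)
    then have "b [^] k \<otimes> c \<in> ?I" using c v by (simp add: I.I_l_closed)
    with regular_pow[OF I.a_subset b reg1 c(1)] show ?thesis by simp
  qed
  have "\<not> is_unit (\<pi> u)"
  proof
    assume "is_unit (\<pi> u)"
    then have "\<one> \<in> P" using mem[of \<one>] by (simp add: proj_one)
    then show False using P.I_notcarr P.one_imp_carrier by simp
  qed
  then obtain e h where h: "\<pi> a = \<pi> u ^ e * h" "\<not> \<pi> u dvd h"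
    using poly_power_factor[OF _ pa] by blast
  obtain w where w: "w \<in> carrier A" "\<pi> w = h" using proj_surj by blast
  have "\<pi> (u [^] e \<otimes> w) = \<pi> a" using w ucarr h by (simp add: proj_mult proj_pow)
  then obtain k :: nat where "(u [^] e \<otimes> w) [^] k \<in> ?I"
    using proj_eq_imp_pow_mem[OF I _ aI, of "u [^] e \<otimes> w"] ucarr w(1) by auto
  then have "u [^] (e * k) \<otimes> w [^] k \<in> ?I"
    using ucarr w by (simp add: nat_pow_distrib nat_pow_pow)
  with regular_pow[OF I.a_subset ucarr regu] have "w [^] k \<in> ?I" using w(1) by simp
  then have "w \<in> P" using P.pow_mem_imp_mem[OF w(1)] IP by blast
  then have "\<pi> u dvd \<pi> w" using u(2) by blast
  then show False using w(2) h(2) by simp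
qed

text \<open>Any element of \<open>P\<close> outside the kernel is a regular sequence by itself;
  longer ones are excluded by \<open>regular_sequence_length_le\<close>.\<close>

lemma depth_maximalideal:
  assumes "maximalideal P A"
  shows "depth A P = 1"
proof -
  have P: "primeideal P A" using maximalideal_prime[OF assms] .
  interpret P: primeideal P A by fact
  obtain p where p: "p \<in> P" "\<pi> p \<noteq> 0"
    using primeideal_kernel_subset[OF P] maximalideal_not_kernel[OF assms] P.Icarr by blast
  have pc: "p \<in> carrier A" using p P.Icarr by blast
  have "Idl {p} \<subseteq> P" using p by (intro genideal_minimal P.is_ideal) simp
  then have "Idl {p} \<noteq> carrier A" using P.I_notcarr P.a_subset by auto
  then have "regular_sequence A [p]"
    using pc regular[OF pc _ p(2)] by (auto simp: regular_sequence_def Idl_empty)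
  then have "1 \<le> depth A P"
    unfolding depth_def using p by (intro Sup_upper CollectI exI[of _ "[p]"]) (simp add: one_enat_def)
  moreover have "depth A P \<le> 1"
    unfolding depth_def
    using regular_sequence_length_le[OF P] by (intro Sup_least) (auto simp: one_enat_def)
  ultimately show ?thesis by (rule antisym[rotated])
qed

theorem cohen_macaulay:
  assumes "noetherian_ring A"
  shows "cohen_macaulay A"
  unfolding cohen_macaulay_def
  using assms cring_axioms by (auto simp: height_maximalideal depth_maximalideal)

end


section \<open>The ring of a semigroup with an order function\<close>

lemma mod_eq_imp_add_mult:
  fixes a b n :: nat
  assumes "a mod n = b mod n" "a \<le> b"
  shows "\<exists>k. b = a + k * n"
proof -
  have "n dvd b - a" using mod_eq_dvd_iff_nat[OF assms(2), of n] assms(1) by simp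
  then obtain k where "b - a = n * k" by (rule dvdE)
  then have "b = a + k * n" using assms(2) by (simp add: mult.commute)
  then show ?thesis ..
qed

text \<open>
  The tangent cone of a semigroup ring has a basis indexed by the semigroup \<open>S\<close>.  The product of the
  basis elements of \<open>s\<close> and \<open>t\<close> is that of \<open>s + t\<close> if the orders add up, and zero otherwise.
  Polynomials supported on \<open>S\<close> serve as finite linear combinations of basis elements.
\<close>
locale ordered_semigroup =
  fixes S :: "nat set" and ord :: "nat \<Rightarrow> nat" and e :: nat
  assumes zero_mem: "0 \<in> S"
    and add_mem: "\<lbrakk>s \<in> S; t \<in> S\<rbrakk> \<Longrightarrow> s + t \<in> S"
    and e_pos: "0 < e"
    and e_mem: "e \<in> S"
    and ord_zero: "ord 0 = 0"
    and ord_add_ge: "\<lbrakk>s \<in> S; t \<in> S\<rbrakk> \<Longrightarrow> ord s + ord t \<le> ord (s + t)"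
    and ord_add_e: "s \<in> S \<Longrightarrow> ord (s + e) = Suc (ord s)"
    and e_mult_ord_le: "s \<in> S \<Longrightarrow> e * ord s \<le> s"
begin

definition supported :: "'k::field poly set" where
  "supported = {f. \<forall>s. coeff f s \<noteq> 0 \<longrightarrow> s \<in> S}"

definition graded_mult :: "'k::field poly \<Rightarrow> 'k poly \<Rightarrow> 'k poly" where
  "graded_mult f g =
    Abs_poly (\<lambda>n. \<Sum>i\<le>n. if ord n = ord i + ord (n - i) then coeff f i * coeff g (n - i) else 0)"

definition graded_ring :: "'k::field poly ring" where
  "graded_ring = \<lparr>carrier = supported, monoid.mult = graded_mult, one = 1, zero = 0, add = (+)\<rparr>"

text \<open>The quotient map onto K[t^e], with t^e renamed to the variable of the polynomial
  ring.\<close>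

definition proj :: "'k::field poly \<Rightarrow> 'k poly" where
  "proj f = Abs_poly (\<lambda>k. coeff f (k * e))"

text \<open>A second grading: it is additive on nonzero products of basis elements and vanishes on
  \<open>S\<close> exactly at the multiples of \<open>e\<close>. The subtraction does not truncate
  on \<open>S\<close>, by \<open>e_mult_ord_le\<close>.\<close>

definition excess :: "nat \<Rightarrow> nat" where
  "excess s = s - e * ord s"

lemma graded_ring_simps:
  "carrier graded_ring = supported" "monoid.mult graded_ring = graded_mult"
  "one graded_ring = 1" "zero graded_ring = 0" "add graded_ring = (+)"
  by (simp_all add: graded_ring_def)

lemma add_mult_mem: "s \<in> S \<Longrightarrow> s + k * e \<in> S"
  by (induction k) (auto simp: add.commute add.left_commute intro: add_mem e_mem)

lemma ord_add_mult: "s \<in> S \<Longrightarrow> ord (s + k * e) = ord s + k"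
proof (induction k)
  case (Suc k)
  have "ord ((s + k * e) + e) = Suc (ord (s + k * e))"
    using Suc.prems by (intro ord_add_e add_mult_mem)
  then show ?case using Suc by (simp add: ac_simps)
qed simp

lemma mult_mem: "k * e \<in> S" and ord_mult: "ord (k * e) = k"
  using add_mult_mem[OF zero_mem, of k] ord_add_mult[OF zero_mem, of k] by (simp_all add: ord_zero)

lemma supported_D: "f \<in> supported \<Longrightarrow> coeff f s \<noteq> 0 \<Longrightarrow> s \<in> S"
  by (simp add: supported_def)

section \<open>The ring structure given by the graded product\<close>

lemma coeff_graded_mult:
  "coeff (graded_mult f g) n =
    (\<Sum>i\<le>n. if ord n = ord i + ord (n - i) then coeff f i * coeff g (n - i) else 0)"
proof -
  let ?c = "\<lambda>n. \<Sum>i\<le>n. if ord n = ord i + ord (n - i) then coeff f i * coeff g (n - i) else 0"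
  have "?c n = 0" if "n > degree f + degree g" for n
  proof (rule sum.neutral, intro ballI)
    fix i
    have "i > degree f \<or> n - i > degree g" using that by linarith
    then show "(if ord n = ord i + ord (n - i) then coeff f i * coeff g (n - i) else 0) = 0"
      by (auto simp: coeff_eq_0)
  qed
  then have "coeff (Abs_poly ?c) = ?c" by (rule coeff_Abs_poly)
  then show ?thesis unfolding graded_mult_def by metis
qed

lemma coeff_graded_mult_nonzeroD:
  assumes "coeff (graded_mult f g) n \<noteq> 0"
  shows "\<exists>i j. n = i + j \<and> coeff f i \<noteq> 0 \<and> coeff g j \<noteq> 0 \<and> ord n = ord i + ord j"
proof -
  obtain i where "i \<in> {..n}"
    "(if ord n = ord i + ord (n - i) then coeff f i * coeff g (n - i) else 0) \<noteq> 0"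
    using assms unfolding coeff_graded_mult by (rule sum.not_neutral_contains_not_neutral)
  then show ?thesis
    by (intro exI[of _ i] exI[of _ "n - i"]) (auto split: if_splits)
qed

lemma graded_mult_closed: "f \<in> supported \<Longrightarrow> g \<in> supported \<Longrightarrow> graded_mult f g \<in> supported"
  unfolding supported_def using coeff_graded_mult_nonzeroD add_mem by blast

lemma graded_mult_commute: "graded_mult f g = graded_mult g f"
proof (rule poly_eqI)
  fix n
  show "coeff (graded_mult f g) n = coeff (graded_mult g f) n"
    unfolding coeff_graded_mult
    by (rule sum.reindex_bij_witness[of _ "\<lambda>i. n - i" "\<lambda>i. n - i"]) (auto simp: ac_simps)
qed

text \<open>By superadditivity, \<open>ord\<close> is additive on a triple exactly if it is additive
  at both steps of either bracketing. Both sides are therefore the same sum of the terms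
  \<open>F i j k\<close>.\<close>

lemma graded_mult_assoc:
  assumes "f \<in> supported" "g \<in> supported" "h \<in> supported"
  shows "graded_mult (graded_mult f g) h = graded_mult f (graded_mult g h)"
proof (rule poly_eqI)
  fix n
  define F where "F i j k =
    (if ord (i + j + k) = ord i + ord j + ord k then coeff f i * coeff g j * coeff h k else 0)" for i j k
  \<comment> \<open>Superadditivity is available only on \<open>S\<close>; outside it the product of
    coefficients vanishes.\<close>
  have orders: "coeff f i * coeff g j * coeff h k = 0 \<or>
      ord i + ord j \<le> ord (i + j) \<and> ord j + ord k \<le> ord (j + k) \<and>
      ord (i + j) + ord k \<le> ord (i + j + k) \<and> ord i + ord (j + k) \<le> ord (i + j + k)" for i j k
  proof (cases "coeff f i * coeff g j * coeff h k = 0")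
    case False
    then have S: "i \<in> S" "j \<in> S" "k \<in> S" using assms supported_D by auto
    then have "ord i + ord (j + k) \<le> ord (i + (j + k))" "ord (i + j) + ord k \<le> ord (i + j + k)"
      by (auto intro: ord_add_ge add_mem)
    then show ?thesis using S ord_add_ge by (simp add: add.assoc)
  qed simp
  have "coeff (graded_mult (graded_mult f g) h) n = (\<Sum>l=0..n. \<Sum>i=0..l. F i (l - i) (n - l))"
    unfolding coeff_graded_mult atMost_atLeast0
  proof (rule sum.cong[OF refl])
    fix l assume l: "l \<in> {0..n}"
    have "(if ord n = ord l + ord (n - l)
        then (if ord l = ord i + ord (l - i) then coeff f i * coeff g (l - i) else 0) * coeff h (n - l)
        else 0) = F i (l - i) (n - l)" if "i \<in> {0..l}" for i
      using orders[of i "l - i" "n - l"] l that by (auto simp: F_def)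
    then show "(if ord n = ord l + ord (n - l)
        then (\<Sum>i=0..l. if ord l = ord i + ord (l - i) then coeff f i * coeff g (l - i) else 0)
          * coeff h (n - l) else 0) = (\<Sum>i=0..l. F i (l - i) (n - l))"
      by (subst sum.cong[OF refl, of _ "\<lambda>i. F i (l - i) (n - l)", symmetric])
        (auto simp: sum_distrib_right)
  qed
  also have "\<dots> = (\<Sum>i=0..n. \<Sum>j=0..n - i. F i j (n - i - j))"
    by (rule fps_mult_assoc_lemma)
  also have "\<dots> = coeff (graded_mult f (graded_mult g h)) n"
    unfolding coeff_graded_mult atMost_atLeast0
  proof (rule sum.cong[OF refl])
    fix i assume i: "i \<in> {0..n}"
    have "F i j (n - i - j) = (if ord n = ord i + ord (n - i)
        then coeff f i * (if ord (n - i) = ord j + ord (n - i - j)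
          then coeff g j * coeff h (n - i - j) else 0)
        else 0)" if "j \<in> {0..n - i}" for j
      using orders[of i j "n - i - j"] i that by (auto simp: F_def mult.assoc)
    then show "(\<Sum>j=0..n - i. F i j (n - i - j)) = (if ord n = ord i + ord (n - i)
        then coeff f i * (\<Sum>j=0..n - i. if ord (n - i) = ord j + ord (n - i - j)
          then coeff g j * coeff h (n - i - j) else 0)
        else 0)"
      by (auto simp: sum_distrib_left)
  qed
  finally show "coeff (graded_mult (graded_mult f g) h) n
    = coeff (graded_mult f (graded_mult g h)) n" .
qed

lemma graded_mult_add: "graded_mult (f + g) h = graded_mult f h + graded_mult g h"
  by (rule poly_eqI)
    (auto simp: coeff_graded_mult distrib_right sum.distrib[symmetric] intro!: sum.cong)

lemma monom_mem: "k \<in> S \<Longrightarrow> monom c k \<in> supported"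
  by (simp add: supported_def)

text \<open>By \<open>ord_add_mult\<close>, orders always add when one exponent is a multiple of
  \<open>e\<close>, so no term of the ordinary product is dropped.\<close>

lemma graded_mult_monom:
  assumes "g \<in> supported"
  shows "graded_mult (monom c (k * e)) g = monom c (k * e) * g"
proof (rule poly_eqI)
  fix n
  have "coeff (graded_mult (monom c (k * e)) g) n = (\<Sum>i\<le>n. if i = k * e then
      (if ord n = ord (k * e) + ord (n - k * e) then c * coeff g (n - k * e) else 0) else 0)"
    unfolding coeff_graded_mult by (rule sum.cong) auto
  also have "\<dots> = (if k * e \<le> n then c * coeff g (n - k * e) else 0)"
    using ord_add_mult[of "n - k * e" k] supported_D[OF assms, of "n - k * e"]
    by (auto simp: sum.delta ord_mult)
  finally show "coeff (graded_mult (monom c (k * e)) g) n = coeff (monom c (k * e) * g) n"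
    by (simp add: coeff_monom_mult)
qed

lemma cring_graded_ring: "cring (graded_ring :: 'k::field poly ring)"
proof (rule cringI)
  have one: "(1 :: 'k poly) \<in> supported" using monom_mem[OF zero_mem, of 1] by (simp add: one_pCons monom_0)
  have one_mult: "graded_mult 1 f = f" if "f \<in> supported" for f :: "'k poly"
    using graded_mult_monom[OF that, of 1 0] by (simp add: monom_0 one_pCons[symmetric])
  show "abelian_group (graded_ring :: 'k poly ring)"
  proof (rule abelian_groupI, unfold graded_ring_simps)
    fix f :: "'k poly" assume "f \<in> supported"
    then have "- f \<in> supported" by (simp add: supported_def)
    then show "\<exists>g\<in>supported. g + f = 0" by (rule bexI[rotated]) simp
  next
    fix f g :: "'k poly" assume "f \<in> supported" "g \<in> supported"
    then show "f + g \<in> supported" by (auto simp: supported_def) (metis add.right_neutral)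
  qed (auto simp: supported_def)
  show "comm_monoid (graded_ring :: 'k poly ring)"
    by (rule comm_monoidI, unfold graded_ring_simps)
      (auto simp: one one_mult graded_mult_closed graded_mult_assoc intro: graded_mult_commute)
qed (simp add: graded_ring_simps graded_mult_add)

section \<open>The projection, its kernel and the nonzerodivisors\<close>

lemma coeff_proj: "coeff (proj f) k = coeff f (k * e)"
proof -
  have "coeff f (k * e) = 0" if "k > degree f" for k
    using that e_pos by (intro coeff_eq_0) (metis less_le_trans mult.right_neutral mult_le_mono2 Suc_leI One_nat_def)
  then have "coeff (Abs_poly (\<lambda>k. coeff f (k * e))) = (\<lambda>k. coeff f (k * e))" by (rule coeff_Abs_poly)
  then show ?thesis by (simp add: proj_def)
qed

text \<open>A product contributing at \<open>k * e\<close> has orders adding up to \<open>k\<close>.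
  Then equality holds in \<open>e * ord i \<le> i\<close> for both exponents, so both are multiples
  of \<open>e\<close>.\<close>

lemma proj_graded_mult:
  assumes "f \<in> supported" "g \<in> supported"
  shows "proj (graded_mult f g) = proj f * proj g"
proof (rule poly_eqI)
  fix k
  let ?t = "\<lambda>i. if ord (k * e) = ord i + ord (k * e - i) then coeff f i * coeff g (k * e - i) else 0"
  have "coeff (proj (graded_mult f g)) k = sum ?t {..k * e}"
    by (simp add: coeff_proj coeff_graded_mult)
  also have "\<dots> = sum ?t ((\<lambda>j. j * e) ` {..k})"
  proof (rule sum.mono_neutral_right)
    show "\<forall>i\<in>{..k * e} - (\<lambda>j. j * e) ` {..k}. ?t i = 0"
    proof (intro ballI, rule ccontr)
      fix i assume i: "i \<in> {..k * e} - (\<lambda>j. j * e) ` {..k}" and "?t i \<noteq> 0"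
      then have o: "k = ord i + ord (k * e - i)" and "coeff f i \<noteq> 0" "coeff g (k * e - i) \<noteq> 0"
        by (auto simp: ord_mult split: if_splits)
      then have "i \<in> S" "k * e - i \<in> S" using assms supported_D by blast+
      then have "e * ord i \<le> i" "e * ord (k * e - i) \<le> k * e - i"
        by (auto intro: e_mult_ord_le)
      moreover have "k * e = e * ord i + e * ord (k * e - i)"
        using arg_cong[OF o, of "\<lambda>x. x * e"] by (simp add: algebra_simps)
      moreover have "i \<le> k * e" using i by simp
      ultimately have "i = ord i * e" by (simp add: mult.commute)
      moreover have "ord i \<le> k" using o by linarith
      ultimately show False using i by blast
    qed
  qed auto
  also have "\<dots> = (\<Sum>j\<le>k. ?t (j * e))"
    using e_pos by (subst sum.reindex) (auto simp: inj_on_def)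
  also have "\<dots> = (\<Sum>j\<le>k. coeff f (j * e) * coeff g ((k - j) * e))"
    by (rule sum.cong) (auto simp: ord_mult diff_mult_distrib[symmetric])
  finally show "coeff (proj (graded_mult f g)) k = coeff (proj f * proj g) k"
    by (simp add: coeff_mult coeff_proj)
qed

lemma excess_add:
  assumes "s \<in> S" "t \<in> S" "ord (s + t) = ord s + ord t"
  shows "excess (s + t) = excess s + excess t"
  using e_mult_ord_le[OF assms(1)] e_mult_ord_le[OF assms(2)]
  unfolding excess_def assms(3) distrib_left by linarith

lemma excess_add_mult: "s \<in> S \<Longrightarrow> excess (s + k * e) = excess s"
  unfolding excess_def using ord_add_mult[of s k] by (simp add: add_mult_distrib2 mult.commute)

lemma excess_eq_0_imp:
  assumes "s \<in> S" "excess s = 0"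
  shows "s = ord s * e"
  using e_mult_ord_le[OF assms(1)] assms(2) by (simp add: excess_def mult.commute)

text \<open>Adding \<open>e\<close> leaves the excess unchanged, so it depends only on the residue
  modulo \<open>e\<close>. The numbers \<open>w r\<close> for residues occurring in \<open>S\<close>
  form the Apery set of \<open>S\<close> with respect to \<open>e\<close>.\<close>

lemma excess_bounded: "\<exists>D. \<forall>s\<in>S. excess s \<le> D"
proof -
  define w where "w r = (LEAST s. s \<in> S \<and> s mod e = r)" for r
  have "excess s = excess (w (s mod e))" if s: "s \<in> S" for s
  proof -
    have s': "s \<in> S \<and> s mod e = s mod e" using s by simp
    have w: "w (s mod e) \<in> S \<and> w (s mod e) mod e = s mod e"
      unfolding w_def by (rule LeastI) (rule s')
    have "w (s mod e) \<le> s" unfolding w_def by (rule Least_le) (rule s')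
    then obtain k where "s = w (s mod e) + k * e" using mod_eq_imp_add_mult w by blast
    then show ?thesis using excess_add_mult[of "w (s mod e)" k] w by simp
  qed
  moreover have "excess (w (s mod e)) \<le> Max (excess ` w ` {..<e})" for s
    using e_pos by (intro Max_ge) auto
  ultimately show ?thesis by metis
qed

text \<open>All exponents of \<open>f\<close> have excess at least one, so those of its
  \<open>k\<close>-th power have excess at least \<open>k\<close>, while the excess is bounded on
  \<open>S\<close>.\<close>

lemma proj_eq_0_imp_nilpotent:
  assumes "f \<in> supported" "proj f = 0"
  shows "\<exists>k::nat. f [^]\<^bsub>graded_ring\<^esub> k = 0"
proof -
  have pos: "excess s \<ge> 1" if "coeff f s \<noteq> 0" for s
  proof (rule ccontr)
    assume "\<not> excess s \<ge> 1"
    then have "s = ord s * e" using supported_D[OF assms(1) that] by (intro excess_eq_0_imp) simp_all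
    then have "coeff (proj f) (ord s) \<noteq> 0" using that by (simp add: coeff_proj)
    then show False using assms(2) by simp
  qed
  have "f [^]\<^bsub>graded_ring\<^esub> k \<in> supported \<and> (\<forall>s. coeff (f [^]\<^bsub>graded_ring\<^esub> k) s \<noteq> 0 \<longrightarrow> k \<le> excess s)" for k :: nat
  proof (induction k)
    case 0
    show ?case using monom_mem[OF zero_mem, of 1]
      by (simp add: nat_pow_def graded_ring_simps one_pCons monom_0)
  next
    case (Suc k)
    have "f [^]\<^bsub>graded_ring\<^esub> Suc k = graded_mult (f [^]\<^bsub>graded_ring\<^esub> k) f"
      by (simp add: nat_pow_def graded_ring_simps)
    moreover have "Suc k \<le> excess s" if "coeff (graded_mult (f [^]\<^bsub>graded_ring\<^esub> k) f) s \<noteq> 0" for s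
    proof -
      note nz = that
      obtain i j where ij: "s = i + j" "coeff (f [^]\<^bsub>graded_ring\<^esub> k) i \<noteq> 0" "coeff f j \<noteq> 0"
        "ord s = ord i + ord j"
        using coeff_graded_mult_nonzeroD[OF nz] by blast
      moreover have "i \<in> S" "j \<in> S" using ij Suc assms(1) supported_D by blast+
      ultimately have "excess s = excess i + excess j" using excess_add by simp
      then show ?thesis using Suc ij pos by (metis Suc_eq_plus1 add_mono)
    qed
    ultimately show ?case using Suc graded_mult_closed[OF _ assms(1)] by simp
  qed
  note power = this
  obtain D where D: "\<And>s. s \<in> S \<Longrightarrow> excess s \<le> D" using excess_bounded by blast
  have "coeff (f [^]\<^bsub>graded_ring\<^esub> Suc D) s = 0" for s
  proof (rule ccontr)
    assume *: "coeff (f [^]\<^bsub>graded_ring\<^esub> Suc D) s \<noteq> 0"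
    then have "s \<in> S" "Suc D \<le> excess s" using power[of "Suc D"] by (auto intro: supported_D)
    then show False using D[of s] by simp
  qed
  then have "f [^]\<^bsub>graded_ring\<^esub> Suc D = 0" by (intro poly_eqI) simp
  then show ?thesis by blast
qed

text \<open>A lowest-term argument, comparing exponents first by excess and then by size. The lowest
  term of \<open>f\<close> sits at a multiple \<open>k * e\<close>, and its product with the lowest
  term of \<open>g\<close> cannot be cancelled.\<close>

lemma proj_neq_0_imp_regular:
  assumes "f \<in> supported" "g \<in> supported" "proj f \<noteq> 0" "graded_mult f g = 0"
  shows "g = 0"
proof (rule ccontr)
  assume "g \<noteq> 0"
  obtain k0 where "coeff (proj f) k0 \<noteq> 0" using assms(3) by (meson leading_coeff_neq_0)
  then have k0: "coeff f (k0 * e) \<noteq> 0" by (simp add: coeff_proj)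
  obtain k where k: "coeff f (k * e) \<noteq> 0" and k_min: "\<And>j. coeff f (j * e) \<noteq> 0 \<Longrightarrow> k \<le> j"
    using ex_has_least_nat[of "\<lambda>k. coeff f (k * e) \<noteq> 0", OF k0, of "\<lambda>k. k"] by blast
  obtain s0 where s0: "coeff g s0 \<noteq> 0" using \<open>g \<noteq> 0\<close> by (meson leading_coeff_neq_0)
  obtain s1 where s1: "coeff g s1 \<noteq> 0" "\<And>t. coeff g t \<noteq> 0 \<Longrightarrow> excess s1 \<le> excess t"
    using ex_has_least_nat[of "\<lambda>s. coeff g s \<noteq> 0", OF s0, of excess] by blast
  have "coeff g s1 \<noteq> 0 \<and> excess s1 = excess s1" using s1 by simp
  from ex_has_least_nat[of "\<lambda>s. coeff g s \<noteq> 0 \<and> excess s = excess s1", OF this, of "\<lambda>s. s"]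
  obtain s where s: "coeff g s \<noteq> 0" "excess s = excess s1"
    and s_min: "\<And>t. coeff g t \<noteq> 0 \<Longrightarrow> excess t = excess s1 \<Longrightarrow> s \<le> t" by blast
  have S: "s \<in> S" using supported_D[OF assms(2) s(1)] .
  let ?n = "s + k * e"
  let ?t = "\<lambda>i. if ord ?n = ord i + ord (?n - i) then coeff f i * coeff g (?n - i) else 0"
  \<comment> \<open>Additivity of the excess and minimality for \<open>g\<close> force
    \<open>i\<close> to have excess zero. Then \<open>i\<close> is a multiple of \<open>e\<close>,
    and the two minimal choices \<open>k * e \<le> i\<close> and \<open>s \<le> ?n - i\<close> leave
    only \<open>i = k * e\<close>.\<close>
  have zero: "?t i = 0" if i: "i \<le> ?n" "i \<noteq> k * e" for i
  proof (rule ccontr)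
    assume "?t i \<noteq> 0"
    then have nz: "coeff f i \<noteq> 0" "coeff g (?n - i) \<noteq> 0" and o: "ord ?n = ord i + ord (?n - i)"
      by (auto split: if_splits)
    then have mem: "i \<in> S" "?n - i \<in> S" using assms supported_D by blast+
    have "excess (i + (?n - i)) = excess i + excess (?n - i)"
      using o i(1) by (intro excess_add mem) simp
    then have *: "excess s = excess i + excess (?n - i)" using i(1) excess_add_mult[OF S, of k] by simp
    moreover have "excess s \<le> excess (?n - i)" using s1(2)[OF nz(2)] s(2) by simp
    ultimately have "excess i = 0" "excess (?n - i) = excess s1" using s(2) by simp_all
    then have "i = ord i * e" "s \<le> ?n - i"
      using excess_eq_0_imp[OF mem(1)] s_min[OF nz(2)] by simp_all
    moreover from this have "k \<le> ord i" using k_min[of "ord i"] nz(1) by simp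
    then have "k * e \<le> ord i * e" by simp
    ultimately show False using i by linarith
  qed
  have "coeff (graded_mult f g) ?n = sum ?t {..?n}" by (rule coeff_graded_mult)
  also have "\<dots> = sum ?t {k * e}"
    by (rule sum.mono_neutral_right) (use zero in auto)
  also have "\<dots> = coeff f (k * e) * coeff g s"
    using ord_add_mult[OF S, of k] by (simp add: ord_mult)
  finally show False using assms(4) k s(1) by simp
qed

lemma poly_mod_nilpotents_graded_ring:
  "poly_mod_nilpotents graded_ring (proj :: 'k::field poly \<Rightarrow> 'k poly)"
proof (intro poly_mod_nilpotents.intro cring_graded_ring poly_mod_nilpotents_axioms.intro,
    unfold graded_ring_simps)
  fix f :: "'k poly"
  \<comment> \<open>A preimage of \<open>f\<close> arises by spreading its coefficients over the
    multiples of \<open>e\<close>, all of which lie in \<open>S\<close>.\<close>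
  define c where "c n = (if e dvd n then coeff f (n div e) else 0)" for n
  have "c n = 0" if "n > degree f * e" for n
  proof (cases "e dvd n")
    case True
    then have "n = n div e * e" by simp
    then have "degree f * e < n div e * e" using that by simp
    then have "degree f < n div e" by simp
    then show ?thesis by (simp add: c_def coeff_eq_0)
  qed (simp add: c_def)
  then have coeff_c: "coeff (Abs_poly c) = c" by (rule coeff_Abs_poly)
  define g where "g = Abs_poly c"
  have g: "coeff g n = c n" for n by (simp add: g_def coeff_c)
  have "n \<in> S" if "coeff g n \<noteq> 0" for n
  proof -
    have "n = n div e * e" using that by (simp add: g c_def split: if_splits)
    then show ?thesis using mult_mem[of "n div e"] by simp
  qed
  then have "g \<in> supported" by (simp add: supported_def)
  moreover have "proj g = f" using e_pos by (intro poly_eqI) (simp add: coeff_proj g c_def)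
  ultimately show "\<exists>g\<in>supported. proj g = f" by blast
next
  show "proj (1 :: 'k poly) = 1"
    using e_pos by (intro poly_eqI) (simp add: coeff_proj coeff_1)
qed (simp_all add: poly_eq_iff[of "proj (_ + _)"] coeff_proj proj_graded_mult
    proj_eq_0_imp_nilpotent proj_neq_0_imp_regular)

text \<open>
  Since multiplication by the basis element of \<open>e\<close> shifts degrees by \<open>e\<close>, an ideal is generated by
  elements of least degree in the residue classes modulo \<open>e\<close>.
\<close>
lemma noetherian_graded_ring: "noetherian_ring (graded_ring :: 'k::field poly ring)"
proof -
  let ?H = "graded_ring :: 'k poly ring"
  interpret cring ?H by (rule cring_graded_ring)
  show ?thesis
  proof (rule noetherian_ringI)
    fix I assume "ideal I ?H"
    then interpret I: ideal I ?H .
    define g :: "nat \<Rightarrow> 'k poly"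
      where "g r = arg_min degree (\<lambda>h. h \<in> I \<and> h \<noteq> 0 \<and> degree h mod e = r)" for r
    have g: "g (degree h mod e) \<in> I \<and> g (degree h mod e) \<noteq> 0
        \<and> degree (g (degree h mod e)) mod e = degree h mod e"
      "degree (g (degree h mod e)) \<le> degree h" if "h \<in> I" "h \<noteq> 0" for h
    proof -
      have h: "h \<in> I \<and> h \<noteq> 0 \<and> degree h mod e = degree h mod e" using that by simp
      show "g (degree h mod e) \<in> I \<and> g (degree h mod e) \<noteq> 0
          \<and> degree (g (degree h mod e)) mod e = degree h mod e"
        unfolding g_def by (rule arg_min_natI) (rule h)
      show "degree (g (degree h mod e)) \<le> degree h"
        unfolding g_def by (rule arg_min_nat_le) (rule h)
    qed
    \<comment> \<open>The intersection discards the arbitrary value of \<open>arg_min\<close> at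
      residues that are no degree of a nonzero element of \<open>I\<close>.\<close>
    define A where "A = I \<inter> g ` {..<e}"
    have A: "finite A" "A \<subseteq> I" by (auto simp: A_def)
    then have A_carr: "A \<subseteq> carrier ?H" using I.a_subset by blast
    interpret J: ideal "Idl\<^bsub>?H\<^esub> A" ?H using A_carr by (rule genideal_ideal)
    have "h \<in> Idl\<^bsub>?H\<^esub> A" if "h \<in> I" for h
      using that
    proof (induction "degree h" arbitrary: h rule: less_induct)
      case less
      show ?case
      proof (cases "h = 0")
        case True
        then show ?thesis using J.zero_closed by (simp add: graded_ring_simps)
      next
        case False
        define u where "u = g (degree h mod e)"
        have u: "u \<in> I" "u \<noteq> 0" "degree u mod e = degree h mod e" "degree u \<le> degree h"
          using g[OF less.prems False] by (simp_all add: u_def)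
        then obtain k where k: "degree h = degree u + k * e" using mod_eq_imp_add_mult by metis
        have u_supp: "u \<in> supported" using I.Icarr[OF u(1)] by (simp add: graded_ring_simps)
        have "u \<in> A" using u(1) e_pos by (simp add: A_def u_def)
        then have uJ: "u \<in> Idl\<^bsub>?H\<^esub> A" using genideal_self[OF A_carr] by blast
        have mult: "monom c (k * e) * u = monom c (k * e) \<otimes>\<^bsub>?H\<^esub> u" "monom c (k * e) \<in> carrier ?H" for c
          using graded_mult_monom[OF u_supp] monom_mem[OF mult_mem] by (simp_all add: graded_ring_simps)
        \<comment> \<open>Subtracting \<open>monom c (k * e) * u\<close> cancels the leading term of
          \<open>h\<close>. By \<open>mult\<close> this ordinary product is also the product in the
          ring.\<close>
        define c where "c = lead_coeff h / lead_coeff u"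
        define h' where "h' = h + monom (- c) (k * e) * u"
        have h'I: "h' \<in> I"
          using I.a_closed[OF less.prems I.I_l_closed[OF u(1) mult(2)]]
          unfolding h'_def mult(1) by (simp add: graded_ring_simps)
        have "h' \<in> Idl\<^bsub>?H\<^esub> A"
        \<comment> \<open>For \<open>h' = 0\<close> the degree need not drop, since \<open>h\<close>
          may be constant.\<close>
        proof (cases "h' = 0")
          case True
          then show ?thesis using J.zero_closed by (simp add: graded_ring_simps)
        next
          case nz: False
          have "coeff h' n = 0" if "n \<ge> degree h" for n
          proof (cases "n = degree h")
            case True
            then show ?thesis using u(2) by (simp add: h'_def coeff_monom_mult k c_def)
          next
            case False
            then have "n > degree h" "n - k * e > degree u" using that k by auto
            then show ?thesis by (simp add: h'_def coeff_monom_mult coeff_eq_0)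
          qed
          then have "degree h' < degree h" using nz by (meson leading_coeff_0_iff not_le)
          then show ?thesis using less.hyps h'I by blast
        qed
        moreover have "monom c (k * e) * u \<in> Idl\<^bsub>?H\<^esub> A"
          using J.I_l_closed[OF uJ mult(2)] by (simp add: mult(1))
        ultimately have "h' + monom c (k * e) * u \<in> Idl\<^bsub>?H\<^esub> A"
          using J.a_closed by (simp add: graded_ring_simps)
        moreover have "h' + monom c (k * e) * u = h"
          by (simp add: h'_def minus_monom[symmetric])
        ultimately show ?thesis by simp
      qed
    qed
    then have "I = Idl\<^bsub>?H\<^esub> A" using genideal_minimal[OF I.is_ideal A(2)] by blast
    then show "\<exists>A\<subseteq>carrier ?H. finite A \<and> I = Idl\<^bsub>?H\<^esub> A" using A(1) A_carr by blast
  qed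
qed

end


section \<open>Transport along ring isomorphisms\<close>

text \<open>An ideal of \<open>B\<close> is generated by the images of finitely many generators of
  its preimage.\<close>

lemma noetherian_ring_iso:
  assumes "noetherian_ring A" "ring B" "\<phi> \<in> ring_iso A B"
  shows "noetherian_ring B"
proof -
  interpret A: noetherian_ring A by fact
  interpret B: ring B by fact
  have hom: "\<phi> \<in> ring_hom A B" and surj: "\<phi> ` carrier A = carrier B"
    using assms(3) by (auto simp: ring_iso_def bij_betw_def)
  interpret \<phi>: ring_hom_ring A B \<phi> using hom by unfold_locales
  show ?thesis
  proof (rule B.noetherian_ringI)
    fix I assume I: "ideal I B"
    obtain X where X: "X \<subseteq> carrier A" "finite X" "{r \<in> carrier A. \<phi> r \<in> I} = Idl\<^bsub>A\<^esub> X"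
      using A.finetely_gen[OF \<phi>.ideal_vimage[OF I]] by blast
    have carr: "\<phi> ` X \<subseteq> carrier B" using X(1) surj by blast
    have J: "ideal (Idl\<^bsub>B\<^esub> (\<phi> ` X)) B" using carr by (rule B.genideal_ideal)
    have "X \<subseteq> {r \<in> carrier A. \<phi> r \<in> Idl\<^bsub>B\<^esub> (\<phi> ` X)}"
      using X(1) B.genideal_self[OF carr] by blast
    then have "Idl\<^bsub>A\<^esub> X \<subseteq> {r \<in> carrier A. \<phi> r \<in> Idl\<^bsub>B\<^esub> (\<phi> ` X)}"
      by (rule A.genideal_minimal[OF \<phi>.ideal_vimage[OF J]])
    moreover have "\<exists>r\<in>Idl\<^bsub>A\<^esub> X. b = \<phi> r" if "b \<in> I" for b
    proof -
      have "b \<in> carrier B" using ideal.Icarr[OF I that] .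
      then obtain r where "r \<in> carrier A" "b = \<phi> r" using surj by blast
      then show ?thesis using that X(3) by blast
    qed
    ultimately have "I \<subseteq> Idl\<^bsub>B\<^esub> (\<phi> ` X)" by blast
    moreover have "\<phi> ` X \<subseteq> I" using X(3) A.genideal_self[OF X(1)] by blast
    then have "Idl\<^bsub>B\<^esub> (\<phi> ` X) \<subseteq> I" by (rule B.genideal_minimal[OF I])
    ultimately show "\<exists>Y\<subseteq>carrier B. finite Y \<and> I = Idl\<^bsub>B\<^esub> Y"
      using carr X(2) by (intro exI[of _ "\<phi> ` X"]) simp
  qed
qed

lemma poly_mod_nilpotents_iso:
  assumes "poly_mod_nilpotents A \<pi>" "cring B" "\<phi> \<in> ring_iso A B"
  shows "poly_mod_nilpotents B (\<pi> \<circ> inv_into (carrier A) \<phi>)"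
proof -
  interpret A: poly_mod_nilpotents A \<pi> by fact
  interpret B: cring B by fact
  define \<psi> where "\<psi> = inv_into (carrier A) \<phi>"
  have "\<psi> \<in> ring_iso B A"
    unfolding \<psi>_def using A.ring_axioms assms(3) by (rule ring_iso_set_sym)
  then have hom: "\<psi> \<in> ring_hom B A" and bij: "bij_betw \<psi> (carrier B) (carrier A)"
    by (auto simp: ring_iso_def)
  interpret \<psi>: ring_hom_ring B A \<psi> using hom by unfold_locales
  have zeroD: "b = \<zero>\<^bsub>B\<^esub>" if "b \<in> carrier B" "\<psi> b = \<zero>\<^bsub>A\<^esub>" for b
    by (rule inj_onD[OF bij_betw_imp_inj_on[OF bij]]) (use that in simp_all)
  show ?thesis
    unfolding \<psi>_def[symmetric]
  proof (intro poly_mod_nilpotents.intro B.cring_axioms poly_mod_nilpotents_axioms.intro)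
    show "\<exists>b\<in>carrier B. (\<pi> \<circ> \<psi>) b = f" for f
    proof -
      obtain a where a: "a \<in> carrier A" "\<pi> a = f" using A.proj_surj by blast
      then obtain b where "b \<in> carrier B" "a = \<psi> b"
        using bij_betw_imp_surj_on[OF bij] by blast
      then show ?thesis using a by auto
    qed
    show "\<exists>k::nat. b [^]\<^bsub>B\<^esub> k = \<zero>\<^bsub>B\<^esub>" if b: "b \<in> carrier B" "(\<pi> \<circ> \<psi>) b = 0" for b
    proof -
      obtain k :: nat where "\<psi> b [^]\<^bsub>A\<^esub> k = \<zero>\<^bsub>A\<^esub>" using A.nilpotent[of "\<psi> b"] b by auto
      then show ?thesis using zeroD[of "b [^]\<^bsub>B\<^esub> k"] b(1) by (auto simp: \<psi>.hom_nat_pow)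
    qed
    show "c = \<zero>\<^bsub>B\<^esub>"
      if "b \<in> carrier B" "c \<in> carrier B" "(\<pi> \<circ> \<psi>) b \<noteq> 0" "b \<otimes>\<^bsub>B\<^esub> c = \<zero>\<^bsub>B\<^esub>" for b c
    proof -
      have "\<psi> b \<otimes>\<^bsub>A\<^esub> \<psi> c = \<zero>\<^bsub>A\<^esub>" using that \<psi>.hom_mult[of b c] by simp
      then have "\<psi> c = \<zero>\<^bsub>A\<^esub>" using A.regular[of "\<psi> b" "\<psi> c"] that by simp
      then show ?thesis using zeroD that by simp
    qed
  qed (simp_all add: A.proj_add A.proj_mult A.proj_one)
qed


section \<open>The maximal ideal of a semigroup ring and its powers\<close>

text \<open>Outside the semigroup this is \<open>Max\<close> of an empty set, so statements about it
  carry membership in the semigroup as a condition.\<close>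

definition semigroup_ord :: "nat list \<Rightarrow> nat \<Rightarrow> nat" where
  "semigroup_ord ns s = Max {sum_list a | a. length a = length ns \<and> weight ns a = s}"

lemma weight_map2_add:
  assumes "length a = length ns" "length b = length ns"
  shows "weight ns (map2 (+) a b) = weight ns a + weight ns b"
  using assms by (simp add: weight_def sum.distrib[symmetric] algebra_simps)

lemma sum_list_map2_add:
  fixes a b :: "nat list"
  assumes "length a = length b"
  shows "sum_list (map2 (+) a b) = sum_list a + sum_list b"
  using assms by (induction a b rule: list_induct2) auto

text \<open>The additive form avoids truncated subtraction.\<close>

lemma weight_list_update:
  assumes "length a = length ns" "i < length ns"
  shows "weight ns (a[i := x]) + a ! i * ns ! i = weight ns a + x * ns ! i"
proof -
  have "weight ns (a[i := x]) = x * ns ! i + (\<Sum>j\<in>{..<length ns} - {i}. a ! j * ns ! j)"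
    using assms by (simp add: weight_def sum.remove[of _ i] cong: sum.cong_simp)
  moreover have "weight ns a = a ! i * ns ! i + (\<Sum>j\<in>{..<length ns} - {i}. a ! j * ns ! j)"
    using assms by (simp add: weight_def sum.remove[of _ i])
  ultimately show ?thesis by simp
qed

locale positive_generators =
  fixes ns :: "nat list"
  assumes pos: "\<forall>k\<in>set ns. 0 < k"
begin

abbreviation "S \<equiv> generated_semigroup ns"
abbreviation "ord \<equiv> semigroup_ord ns"

section \<open>The order function of the semigroup\<close>

lemma finite_lengths: "finite {sum_list a | a. length a = length ns \<and> weight ns a = s}"
  using finite_imageI[OF finite_weight_fibre[OF pos, of s], of sum_list]
  by (simp add: setcompr_eq_image)

lemma sum_list_le_ord: "length a = length ns \<Longrightarrow> sum_list a \<le> ord (weight ns a)"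
  unfolding semigroup_ord_def by (rule Max_ge[OF finite_lengths]) blast

lemma ord_attained:
  assumes "s \<in> S"
  obtains a where "length a = length ns" "weight ns a = s" "sum_list a = ord s"
proof -
  obtain b where "s = weight ns b" "length b = length ns"
    using assms unfolding generated_semigroup_def by blast
  then have "{sum_list a | a. length a = length ns \<and> weight ns a = s} \<noteq> {}" by blast
  then have "ord s \<in> {sum_list a | a. length a = length ns \<and> weight ns a = s}"
    unfolding semigroup_ord_def by (rule Max_in[OF finite_lengths])
  then obtain a where "ord s = sum_list a" "length a = length ns \<and> weight ns a = s"
    by (elim CollectE exE conjE) simp
  then show ?thesis using that[of a] by simp
qed

lemma ord_add_ge:
  assumes "s \<in> S" "t \<in> S"
  shows "ord s + ord t \<le> ord (s + t)"
proof -
  obtain a where a: "length a = length ns" "weight ns a = s" "sum_list a = ord s"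
    using assms(1) by (rule ord_attained)
  obtain b where b: "length b = length ns" "weight ns b = t" "sum_list b = ord t"
    using assms(2) by (rule ord_attained)
  show ?thesis
    using sum_list_le_ord[of "map2 (+) a b"] a b by (simp add: weight_map2_add sum_list_map2_add)
qed

text \<open>A longest factorization of \<open>s\<close> has \<open>ord s\<close> parts, each at
  least \<open>e\<close>.\<close>

lemma ord_mult_le:
  assumes "\<forall>k\<in>set ns. e \<le> k" "s \<in> S"
  shows "e * ord s \<le> s"
proof -
  obtain a where a: "length a = length ns" "weight ns a = s" "sum_list a = ord s"
    using assms(2) by (rule ord_attained)
  have "e * sum_list a = (\<Sum>i<length ns. e * a ! i)"
    using a(1) by (simp add: sum_list_sum_nth atLeast0LessThan sum_distrib_left)
  also have "\<dots> = (\<Sum>i<length ns. a ! i * e)" by (simp only: mult.commute)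
  also have "\<dots> \<le> weight ns a"
    unfolding weight_def using assms(1) by (intro sum_mono mult_le_mono) auto
  finally show ?thesis using a by simp
qed

lemma ord_zero: "ord 0 = 0"
proof -
  have "\<forall>k\<in>set ns. 1 \<le> k" using pos by auto
  from ord_mult_le[OF this zero_in_generated_semigroup] show ?thesis by simp
qed

lemma generator_mem: "i < length ns \<Longrightarrow> ns ! i \<in> S"
  and ord_generator_ge: "i < length ns \<Longrightarrow> 1 \<le> ord (ns ! i)"
proof -
  assume i: "i < length ns"
  let ?a = "(replicate (length ns) 0)[i := 1 :: nat]"
  have "weight ns (replicate (length ns) 0) = 0" by (simp add: weight_def)
  then have a: "length ?a = length ns" "weight ns ?a = ns ! i"
    using weight_list_update[of "replicate (length ns) 0" ns i 1] i by simp_all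
  then show "ns ! i \<in> S" unfolding generated_semigroup_def by (intro CollectI exI[of _ ?a]) simp
  have "?a ! i \<le> sum_list ?a" by (rule elem_le_sum_list) (use i in simp)
  then show "1 \<le> ord (ns ! i)" using sum_list_le_ord[OF a(1)] a(2) i by simp
qed

text \<open>Remove one generator from a longest factorization of \<open>s\<close>; what remains
  still has at least \<open>n\<close> parts.\<close>

lemma ord_ge_SucE:
  assumes "s \<in> S" "Suc n \<le> ord s"
  obtains i where "i < length ns" "ns ! i \<le> s" "s - ns ! i \<in> S" "n \<le> ord (s - ns ! i)"
proof -
  obtain a where a: "length a = length ns" "weight ns a = s" "sum_list a = ord s"
    using assms(1) by (rule ord_attained)
  have "sum_list a \<noteq> 0" using a(3) assms(2) by simp
  then obtain i where i: "i < length ns" "a ! i \<noteq> 0"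
    using a(1) by (auto simp: in_set_conv_nth)
  let ?b = "a[i := a ! i - 1]"
  have "weight ns ?b + a ! i * ns ! i = s + (a ! i - 1) * ns ! i"
    using weight_list_update[OF a(1) i(1)] a(2) by simp
  moreover have "a ! i * ns ! i = (a ! i - 1) * ns ! i + ns ! i"
    using i(2) by (simp add: diff_mult_distrib)
  ultimately have b: "weight ns ?b + ns ! i = s" by linarith
  have "a ! i \<le> sum_list a" using a(1) i(1) by (intro elem_le_sum_list) simp
  then have "sum_list ?b + 1 = sum_list a"
    using a(1) i by (simp add: sum_list_update)
  then have "n \<le> ord (weight ns ?b)"
    using sum_list_le_ord[of ?b] a assms(2) by simp
  moreover have "weight ns ?b \<in> S" using a(1) by (auto simp: generated_semigroup_def)
  ultimately show ?thesis using that[OF i(1)] b by (metis diff_add_inverse2 le_add2)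
qed

section \<open>The filtration by order and the powers of the maximal ideal\<close>

abbreviation R :: "'k::field fps ring" where "R \<equiv> power_series_ring ns"

definition filtration :: "nat \<Rightarrow> 'k::field fps set" where
  "filtration n = {f. \<forall>s. fps_nth f s \<noteq> 0 \<longrightarrow> s \<in> S \<and> n \<le> ord s}"

lemma R_simps:
  "monoid.mult R = (*)" "one R = 1" "zero R = 0" "add R = (+)"
  by (simp_all add: power_series_ring_def)

lemma carrier_R: "carrier R = filtration 0"
  by (simp add: carrier_power_series_ring[OF pos] filtration_def)

lemma filtration_D: "f \<in> filtration n \<Longrightarrow> fps_nth f s \<noteq> 0 \<Longrightarrow> s \<in> S \<and> n \<le> ord s"
  by (simp add: filtration_def)

lemma filtration_mono: "n \<le> k \<Longrightarrow> filtration k \<subseteq> filtration n"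
  unfolding filtration_def by (intro Collect_mono) (meson order_trans)

lemma filtration_carrier: "filtration n \<subseteq> carrier R"
  unfolding carrier_R by (rule filtration_mono) simp

lemma filtration_add:
  assumes "f \<in> filtration n" "g \<in> filtration n"
  shows "f + g \<in> filtration n"
  unfolding filtration_def
proof (intro CollectI allI impI)
  fix s assume "fps_nth (f + g) s \<noteq> 0"
  then have "fps_nth f s \<noteq> 0 \<or> fps_nth g s \<noteq> 0" by auto
  then show "s \<in> S \<and> n \<le> ord s" using filtration_D assms by blast
qed

lemma filtration_zero: "0 \<in> filtration n"
  by (simp add: filtration_def)

lemma filtration_mult:
  assumes "f \<in> filtration i" "g \<in> filtration j"
  shows "f * g \<in> filtration (i + j)"
  unfolding filtration_def
proof (intro CollectI allI impI)
  fix s assume "fps_nth (f * g) s \<noteq> 0"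
  then have "(\<Sum>t=0..s. fps_nth f t * fps_nth g (s - t)) \<noteq> 0" by (simp add: fps_mult_nth)
  then obtain t where "t \<in> {0..s}" "fps_nth f t * fps_nth g (s - t) \<noteq> 0"
    by (rule sum.not_neutral_contains_not_neutral)
  then have t: "t \<le> s" "t \<in> S" "s - t \<in> S" "i \<le> ord t" "j \<le> ord (s - t)"
    using filtration_D[OF assms(1), of t] filtration_D[OF assms(2), of "s - t"] by auto
  then show "s \<in> S \<and> i + j \<le> ord s"
    using ord_add_ge[of t "s - t"] add_in_generated_semigroup[of t ns "s - t"] by simp
qed

lemma filtration_ideal: "ideal (filtration n :: 'k::field fps set) R"
proof -
  interpret cring "R :: 'k fps ring" using pos by (rule cring_power_series_ring)
  show ?thesis
  proof (rule idealI)
    show "ring (R :: 'k fps ring)" by (rule ring_axioms)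
    show "subgroup (filtration n) (add_monoid (R :: 'k fps ring))"
    proof (rule add.subgroupI)
      show "(filtration n :: 'k fps set) \<noteq> {}" using filtration_zero by blast
      fix f :: "'k fps" assume f: "f \<in> filtration n"
      then have "f \<oplus>\<^bsub>R\<^esub> (\<ominus>\<^bsub>R\<^esub> f) = \<zero>\<^bsub>R\<^esub>" using filtration_carrier by (intro r_neg) blast
      then have "\<ominus>\<^bsub>R\<^esub> f = - f" by (simp add: R_simps eq_neg_iff_add_eq_0 add.commute)
      then show "\<ominus>\<^bsub>R\<^esub> f \<in> filtration n" using f by (simp add: filtration_def)
    qed (use filtration_carrier filtration_add in \<open>auto simp: R_simps\<close>)
  next
    fix f g :: "'k fps" assume "f \<in> filtration n" "g \<in> carrier R"
    then show "g \<otimes>\<^bsub>R\<^esub> f \<in> filtration n" "f \<otimes>\<^bsub>R\<^esub> g \<in> filtration n"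
      using filtration_mult[of f n g 0] by (simp_all add: R_simps carrier_R mult.commute)
  qed
qed

lemma minus_R:
  fixes f g :: "'k::field fps"
  assumes "f \<in> carrier R" "g \<in> carrier R"
  shows "f \<ominus>\<^bsub>R\<^esub> g = f - g"
proof -
  interpret cring "R :: 'k fps ring" using pos by (rule cring_power_series_ring)
  have "(f \<ominus>\<^bsub>R\<^esub> g) \<oplus>\<^bsub>R\<^esub> g = f" using assms by algebra
  then have "(f \<ominus>\<^bsub>R\<^esub> g) + g = f" by (simp add: R_simps)
  then show ?thesis by (simp add: algebra_simps)
qed

text \<open>For the harder inclusion, each exponent \<open>s\<close> of \<open>f\<close> is assigned
  a generator that can be split off by \<open>ord_ge_SucE\<close>. Grouping terms by generator
  writes even an infinite series as a finite sum of products.\<close>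

lemma filtration_Suc:
  "(filtration (Suc n) :: 'k::field fps set) = ideal_prod R (filtration n) (filtration 1)"
  (is "?F = ?P")
proof
  show "?P \<subseteq> ?F"
  proof
    fix f assume "f \<in> ?P"
    then show "f \<in> filtration (Suc n)"
    proof induction
      case (prod f g)
      then show ?case using filtration_mult[of f n g 1] by (simp add: R_simps)
    next
      case (sum f g)
      then show ?case by (simp add: R_simps filtration_add)
    qed
  qed
  show "?F \<subseteq> ?P"
  proof
    fix f :: "'k fps" assume f: "f \<in> filtration (Suc n)"
    have "\<exists>i. i < length ns \<and> ns ! i \<le> s \<and> s - ns ! i \<in> S \<and> n \<le> ord (s - ns ! i)"
      if "fps_nth f s \<noteq> 0" for s
      using filtration_D[OF f that] ord_ge_SucE by metis
    then obtain idx where idx: "\<And>s. fps_nth f s \<noteq> 0 \<Longrightarrow>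
      idx s < length ns \<and> ns ! idx s \<le> s \<and> s - ns ! idx s \<in> S \<and> n \<le> ord (s - ns ! idx s)"
      by metis
    \<comment> \<open>The terms of \<open>f\<close> assigned to generator \<open>i\<close>, divided
      by the corresponding power of t.\<close>
    define g where "g i = Abs_fps (\<lambda>t. if idx (t + ns ! i) = i then fps_nth f (t + ns ! i) else 0)" for i
    have g: "g i \<in> filtration n" for i
      unfolding filtration_def
    proof (intro CollectI allI impI)
      fix t assume "fps_nth (g i) t \<noteq> 0"
      then have "idx (t + ns ! i) = i" "fps_nth f (t + ns ! i) \<noteq> 0"
        by (simp_all add: g_def split: if_splits)
      then show "t \<in> S \<and> n \<le> ord t" using idx[of "t + ns ! i"] by simp
    qed
    have x: "fps_X ^ (ns ! i) \<in> filtration 1" if "i < length ns" for i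
      using generator_mem[OF that] ord_generator_ge[OF that]
      by (simp add: filtration_def fps_X_power_nth)
    have gx: "g i * fps_X ^ (ns ! i) \<in> ?P" if "i < length ns" for i
      using ideal_prod.prod[OF g x[OF that], of R] by (simp add: R_simps)
    have "(\<Sum>i<k. g i * fps_X ^ (ns ! i)) \<in> ?P"
      if "k \<le> length ns" for k
      using that
    proof (induction k)
      case 0
      show ?case using ideal_prod.prod[OF filtration_zero filtration_zero, of R n 1] by (simp add: R_simps)
    next
      case (Suc k)
      then show ?case using ideal_prod.sum[OF Suc.IH gx[of k]] by (simp add: R_simps)
    qed
    moreover have "f = (\<Sum>i<length ns. g i * fps_X ^ (ns ! i))"
    proof (rule fps_ext)
      fix s
      have "fps_nth (\<Sum>i<length ns. g i * fps_X ^ (ns ! i)) s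
          = (\<Sum>i<length ns. if s < ns ! i then 0 else fps_nth (g i) (s - ns ! i))"
        by (simp add: fps_sum_nth fps_X_power_mult_right_nth)
      also have "\<dots> = (\<Sum>i<length ns. if i = idx s then fps_nth f s else 0)"
        using idx[of s] by (cases "fps_nth f s = 0"; intro sum.cong) (auto simp: g_def)
      also have "\<dots> = fps_nth f s" using idx[of s] by (auto simp: sum.delta)
      finally show "fps_nth f s = fps_nth (\<Sum>i<length ns. g i * fps_X ^ (ns ! i)) s" by simp
    qed
    ultimately show "f \<in> ?P" by simp
  qed
qed

text \<open>A nonzero element of \<open>S\<close> uses at least one generator, whereas
  \<open>ord 0 = 0\<close>. Having no constant term therefore means having order at least
  one.\<close>

lemma maximalideal_eq_filtration:
  fixes M :: "'k::field fps set"
  assumes "maximalideal M R"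
  shows "M = filtration 1"
proof -
  have ord_pos: "1 \<le> ord s" if "s \<in> S" "s \<noteq> 0" for s
  proof -
    note s = that
    obtain a where a: "length a = length ns" "weight ns a = s" "sum_list a = ord s"
      using s(1) by (rule ord_attained)
    have "sum_list a \<noteq> 0"
    proof
      assume "sum_list a = 0"
      then have "weight ns a = 0" using a(1) by (simp add: weight_def)
      then show False using a(2) s(2) by simp
    qed
    then show ?thesis using a(3) by simp
  qed
  have "{f \<in> carrier R. fps_nth f 0 = 0} = (filtration 1 :: 'k fps set)"
  proof (intro equalityI subsetI)
    fix f :: "'k fps" assume "f \<in> {f \<in> carrier R. fps_nth f 0 = 0}"
    then have f: "f \<in> filtration 0" "fps_nth f 0 = 0" by (simp_all add: carrier_R)
    then have "s \<in> S \<and> 1 \<le> ord s" if "fps_nth f s \<noteq> 0" for s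
      using filtration_D[OF f(1) that] ord_pos[of s] that by (cases "s = 0") simp_all
    then show "f \<in> filtration 1" unfolding filtration_def by blast
  next
    fix f :: "'k fps" assume f: "f \<in> filtration 1"
    then have "fps_nth f 0 = 0" using filtration_D[OF f, of 0] ord_zero by force
    then show "f \<in> {f \<in> carrier R. fps_nth f 0 = 0}" using filtration_carrier f by blast
  qed
  moreover have "M = {f \<in> carrier R. fps_nth f 0 = 0}"
    using maximalideal_power_series_ring_iff[OF pos, of M] assms by (rule iffD1)
  ultimately show ?thesis by simp
qed

lemma maximalideal_pow:
  assumes "maximalideal M R"
  shows "M [^]\<^bsub>ideals_set R\<^esub> n = filtration n"
proof (induction n)
  case 0
  show ?case by (simp add: nat_pow_def ideals_set_def carrier_R)
next
  case (Suc n)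
  then show ?case
    unfolding filtration_Suc maximalideal_eq_filtration[OF assms]
    by (simp add: nat_pow_def ideals_set_def)
qed

end


section \<open>The tangent cone\<close>

text \<open>The smallest generator takes the part of \<open>e\<close>: \<open>least\<close> yields
  \<open>e * ord s \<le> s\<close>, and the last condition makes its class in degree one a
  nonzerodivisor.\<close>

locale order_raising_generators = positive_generators +
  assumes nonempty: "ns \<noteq> []"
    and least: "\<forall>k\<in>set ns. ns ! 0 \<le> k"
    and ord_add_least: "s \<in> generated_semigroup ns \<Longrightarrow>
      semigroup_ord ns (s + ns ! 0) = Suc (semigroup_ord ns s)"
begin

sublocale H: ordered_semigroup S ord "ns ! 0"
proof
  show "0 < ns ! 0" using pos nonempty by simp
  show "ns ! 0 \<in> S" using nonempty by (intro generator_mem) simp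
  show "ns ! 0 * ord s \<le> s" if "s \<in> S" for s using least that by (rule ord_mult_le)
qed (use zero_in_generated_semigroup add_in_generated_semigroup ord_zero ord_add_ge ord_add_least in blast)+

text \<open>The associated graded ring with the powers of the maximal ideal replaced by the explicit
  filtration.\<close>

definition tangent_cone :: "(nat \<Rightarrow> 'k::field fps set) ring" where
  "tangent_cone =
    \<lparr>carrier = {g. (\<forall>n. \<exists>x\<in>filtration n. g n = filtration (Suc n) +>\<^bsub>R\<^esub> x) \<and>
       finite {n. g n \<noteq> filtration (Suc n)}},
     monoid.mult = (\<lambda>g h n. finsum (R Quot filtration (Suc n))
        (\<lambda>i. rcoset_mult R (filtration (Suc n)) (g i) (h (n - i))) {..n}),
     one = (\<lambda>n. if n = 0 then filtration 1 +>\<^bsub>R\<^esub> 1 else filtration (Suc n)),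
     zero = (\<lambda>n. filtration (Suc n)),
     add = (\<lambda>g h n. g n <+>\<^bsub>R\<^esub> h n)\<rparr>"

lemma assoc_graded_ring_eq:
  fixes M :: "'k::field fps set"
  assumes "maximalideal M R"
  shows "assoc_graded_ring R M = tangent_cone"
  unfolding assoc_graded_ring_def tangent_cone_def Let_def maximalideal_pow[OF assms]
  by (simp only: R_simps)

section \<open>The isomorphism from the graded ring onto the tangent cone\<close>

definition component :: "'k::field poly \<Rightarrow> nat \<Rightarrow> 'k fps" where
  "component h n = Abs_fps (\<lambda>s. if s \<in> S \<and> ord s = n then coeff h s else 0)"

definition to_cone :: "'k::field poly \<Rightarrow> nat \<Rightarrow> 'k fps set" where
  "to_cone h n = filtration (Suc n) +>\<^bsub>R\<^esub> component h n"

lemma nth_component: "fps_nth (component h n) s = (if s \<in> S \<and> ord s = n then coeff h s else 0)"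
  by (simp add: component_def)

lemma component_mem: "component h n \<in> filtration n"
  by (simp add: filtration_def nth_component)

lemma component_carrier: "component h n \<in> carrier R"
  using component_mem filtration_carrier by blast

text \<open>The difference has to be supported in orders above \<open>n\<close>; outside
  \<open>S\<close> both series vanish anyway.\<close>

lemma coset_eq_iff:
  fixes x y :: "'k::field fps"
  assumes "x \<in> carrier R" "y \<in> carrier R"
  shows "filtration (Suc n) +>\<^bsub>R\<^esub> x = filtration (Suc n) +>\<^bsub>R\<^esub> y \<longleftrightarrow>
    (\<forall>s\<in>S. ord s \<le> n \<longrightarrow> fps_nth x s = fps_nth y s)"
proof -
  interpret cring "R :: 'k fps ring" using pos by (rule cring_power_series_ring)
  have out: "fps_nth x s = 0" "fps_nth y s = 0" if "s \<notin> S" for s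
    using assms that filtration_D[of _ 0 s] unfolding carrier_R by blast+
  have "filtration (Suc n) +>\<^bsub>R\<^esub> x = filtration (Suc n) +>\<^bsub>R\<^esub> y \<longleftrightarrow> x - y \<in> filtration (Suc n)"
    using quotient_eq_iff_same_a_r_cos[OF filtration_ideal assms] minus_R[OF assms] by simp
  also have "\<dots> \<longleftrightarrow> (\<forall>s. fps_nth x s \<noteq> fps_nth y s \<longrightarrow> s \<in> S \<and> Suc n \<le> ord s)"
    by (simp add: filtration_def)
  also have "\<dots> \<longleftrightarrow> (\<forall>s\<in>S. ord s \<le> n \<longrightarrow> fps_nth x s = fps_nth y s)"
    using out not_less_eq_eq by metis
  finally show ?thesis .
qed

lemma filtration_coset_zero: "(filtration (Suc n) :: 'k::field fps set) +>\<^bsub>R\<^esub> 0 = filtration (Suc n)"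
  using cring.axioms(1)[OF cring_power_series_ring[OF pos]] filtration_ideal filtration_zero
  by (rule ring.a_rcos_zero)

lemma coset_mem:
  fixes x :: "'k::field fps"
  shows "a \<in> filtration n +>\<^bsub>R\<^esub> x \<longleftrightarrow> (\<exists>p\<in>filtration n. a = p + x)"
  by (auto simp: a_r_coset_def r_coset_def R_simps)

text \<open>\<open>rcoset_mult\<close> is a union over all representatives, here of cosets modulo
  different ideals. Replacing \<open>x\<close>, \<open>y\<close> by \<open>p + x\<close>,
  \<open>q + y\<close> changes the product by \<open>p * b + x * q\<close> with
  \<open>b = q + y\<close>, of order at least \<open>i + j + 1\<close>.\<close>

lemma rcoset_mult_filtration:
  fixes x y :: "'k::field fps"
  assumes "x \<in> filtration i" "y \<in> filtration j"
  shows "rcoset_mult R (filtration (Suc (i + j)))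
      (filtration (Suc i) +>\<^bsub>R\<^esub> x) (filtration (Suc j) +>\<^bsub>R\<^esub> y)
    = filtration (Suc (i + j)) +>\<^bsub>R\<^esub> (x * y)"
proof -
  interpret cring "R :: 'k fps ring" using pos by (rule cring_power_series_ring)
  have const: "filtration (Suc (i + j)) +>\<^bsub>R\<^esub> (a * b) = filtration (Suc (i + j)) +>\<^bsub>R\<^esub> (x * y)"
    if a: "a \<in> filtration (Suc i) +>\<^bsub>R\<^esub> x" and b: "b \<in> filtration (Suc j) +>\<^bsub>R\<^esub> y" for a b
  proof -
    obtain p where p: "p \<in> filtration (Suc i)" "a = p + x" using a unfolding coset_mem by blast
    obtain q where q: "q \<in> filtration (Suc j)" "b = q + y" using b unfolding coset_mem by blast
    have b_mem: "b \<in> filtration j"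
      using filtration_add[OF _ assms(2), of q] filtration_mono[of j "Suc j"] q by auto
    have a_mem: "a \<in> filtration i"
      using filtration_add[OF _ assms(1), of p] filtration_mono[of i "Suc i"] p by auto
    have "p * b + x * q \<in> filtration (Suc (i + j))"
      using filtration_add[OF _ filtration_mult[OF assms(1) q(1)], of "p * b"]
        filtration_mult[OF p(1) b_mem] by simp
    moreover have "a * b - x * y = p * b + x * q" using p(2) q(2) by (simp add: algebra_simps)
    moreover have carr: "a * b \<in> carrier R" "x * y \<in> carrier R"
      using filtration_mult[OF a_mem b_mem] filtration_mult[OF assms] filtration_carrier by blast+
    ultimately show ?thesis
      using quotient_eq_iff_same_a_r_cos[OF filtration_ideal carr, of "Suc (i + j)"] minus_R[OF carr]
      by simp
  qed
  have "x \<in> filtration (Suc i) +>\<^bsub>R\<^esub> x" "y \<in> filtration (Suc j) +>\<^bsub>R\<^esub> y"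
    unfolding coset_mem by (intro bexI[OF _ filtration_zero]; simp)+
  then show ?thesis
    unfolding rcoset_mult_def R_simps using const by blast
qed

text \<open>The coset map is a ring homomorphism, and \<open>finsum\<close> in \<open>R\<close> is
  the ordinary sum.\<close>

lemma finsum_cosets:
  fixes c :: "nat \<Rightarrow> 'k::field fps"
  assumes "\<And>i. i \<in> A \<Longrightarrow> c i \<in> carrier R"
  shows "finsum (R Quot filtration n) (\<lambda>i. filtration n +>\<^bsub>R\<^esub> c i) A = filtration n +>\<^bsub>R\<^esub> sum c A"
    and "sum c A \<in> carrier R"
proof -
  interpret cring "R :: 'k fps ring" using pos by (rule cring_power_series_ring)
  have c: "c \<in> A \<rightarrow> carrier R" using assms by blast
  have closed: "finsum R c A \<in> carrier R" using c by (rule finsum_closed)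
  have finsum: "finsum R c A = sum c A" using assms
  proof (induction A rule: infinite_finite_induct)
    case (insert i A)
    then have "finsum R c (insert i A) = c i \<oplus>\<^bsub>R\<^esub> finsum R c A"
      by (intro finsum_insert) auto
    then show ?case using insert by (simp add: R_simps)
  qed (simp_all add: R_simps finsum_infinite)
  interpret I: ideal "filtration n :: 'k fps set" R by (rule filtration_ideal)
  interpret ring_hom_cring R "R Quot filtration n" "(+>\<^bsub>R\<^esub>) (filtration n :: 'k fps set)"
    by (rule I.rcos_ring_hom_cring[OF cring_axioms])
  show "finsum (R Quot filtration n) (\<lambda>i. filtration n +>\<^bsub>R\<^esub> c i) A = filtration n +>\<^bsub>R\<^esub> sum c A"
    and "sum c A \<in> carrier R"
    using hom_finsum[OF c] closed finsum by (simp_all add: comp_def)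
qed

lemma to_cone_add: "to_cone (g + h) = to_cone g \<oplus>\<^bsub>tangent_cone\<^esub> (to_cone h :: nat \<Rightarrow> 'k::field fps set)"
proof
  fix n
  interpret I: ideal "filtration (Suc n) :: 'k fps set" R by (rule filtration_ideal)
  have "component (g + h) n = component g n + component h n"
    by (rule fps_ext) (simp add: nth_component)
  then show "to_cone (g + h) n = (to_cone g \<oplus>\<^bsub>tangent_cone\<^esub> to_cone h) n"
    using I.a_rcos_sum[OF component_carrier component_carrier, of g n h n]
    by (simp add: to_cone_def tangent_cone_def R_simps)
qed

text \<open>In degree \<open>n\<close> only exponents \<open>s\<close> with
  \<open>ord s \<le> n\<close> matter. Those of order \<open>n\<close> receive the terms of
  \<open>graded_mult\<close>; those of smaller order receive none, by superadditivity.\<close>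

lemma to_cone_mult:
  fixes g h :: "'k::field poly"
  assumes "g \<in> H.supported" "h \<in> H.supported"
  shows "to_cone (H.graded_mult g h) = to_cone g \<otimes>\<^bsub>tangent_cone\<^esub> to_cone h"
proof
  fix n
  define c where "c i = component g i * component h (n - i)" for i
  have c: "c i \<in> carrier R" for i
    unfolding c_def using filtration_mult[OF component_mem component_mem] filtration_carrier by blast
  have "(to_cone g \<otimes>\<^bsub>tangent_cone\<^esub> to_cone h) n = finsum (R Quot filtration (Suc n))
      (\<lambda>i. rcoset_mult R (filtration (Suc n)) (to_cone g i) (to_cone h (n - i))) {..n}"
    by (simp add: tangent_cone_def)
  also have "\<dots> = finsum (R Quot filtration (Suc n)) (\<lambda>i. filtration (Suc n) +>\<^bsub>R\<^esub> c i) {..n}"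
  proof -
    interpret Q: ring "R Quot (filtration (Suc n) :: 'k fps set)"
      by (rule ideal.quotient_is_ring[OF filtration_ideal])
    show ?thesis
    proof (rule Q.finsum_cong'[OF refl])
      show "(\<lambda>i. filtration (Suc n) +>\<^bsub>R\<^esub> c i) \<in> {..n} \<rightarrow> carrier (R Quot filtration (Suc n))"
        using ring_hom_closed[OF ideal.rcos_ring_hom[OF filtration_ideal] c] by blast
      fix i assume "i \<in> {..n}"
      then have "i + (n - i) = n" by simp
      then show "rcoset_mult R (filtration (Suc n)) (to_cone g i) (to_cone h (n - i))
          = filtration (Suc n) +>\<^bsub>R\<^esub> c i"
        using rcoset_mult_filtration[OF component_mem[of g i] component_mem[of h "n - i"]]
        by (simp add: to_cone_def c_def)
    qed
  qed
  also have "\<dots> = filtration (Suc n) +>\<^bsub>R\<^esub> sum c {..n}" using c by (rule finsum_cosets)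
  also have "\<dots> = to_cone (H.graded_mult g h) n"
    unfolding to_cone_def
  proof (subst coset_eq_iff)
    show "sum c {..n} \<in> carrier R" using c by (rule finsum_cosets)
    show "component (H.graded_mult g h) n \<in> carrier R" by (rule component_carrier)
    show "\<forall>s\<in>S. ord s \<le> n \<longrightarrow> fps_nth (sum c {..n}) s = fps_nth (component (H.graded_mult g h) n) s"
    proof (intro ballI impI)
      fix s assume s: "s \<in> S" "ord s \<le> n"
      let ?t = "\<lambda>t. if ord t + ord (s - t) = n then coeff g t * coeff h (s - t) else 0"
      \<comment> \<open>For fixed \<open>t\<close> only the degree \<open>i = ord t\<close>
        contributes, which collapses the sum over degrees.\<close>
      have inner: "(\<Sum>i\<le>n. fps_nth (component g i) t * fps_nth (component h (n - i)) (s - t)) = ?t t" for t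
      proof (cases "coeff g t = 0 \<or> coeff h (s - t) = 0")
        case True
        then show ?thesis by (auto simp: nth_component intro!: sum.neutral)
      next
        case False
        then have "t \<in> S" "s - t \<in> S" using assms H.supported_D by blast+
        then have "(\<Sum>i\<le>n. fps_nth (component g i) t * fps_nth (component h (n - i)) (s - t))
            = (\<Sum>i\<le>n. if i = ord t then (if ord (s - t) = n - i then coeff g t * coeff h (s - t) else 0) else 0)"
          by (intro sum.cong) (auto simp: nth_component)
        also have "\<dots> = ?t t" by (auto simp: sum.delta)
        finally show ?thesis .
      qed
      have "fps_nth (sum c {..n}) s
          = (\<Sum>i\<le>n. \<Sum>t=0..s. fps_nth (component g i) t * fps_nth (component h (n - i)) (s - t))"
        by (simp add: fps_sum_nth c_def fps_mult_nth)
      also have "\<dots> = (\<Sum>t=0..s. \<Sum>i\<le>n. fps_nth (component g i) t * fps_nth (component h (n - i)) (s - t))"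
        by (rule sum.swap)
      also have "\<dots> = (\<Sum>t\<le>s. ?t t)" by (simp only: inner atMost_atLeast0[of s])
      also have "\<dots> = fps_nth (component (H.graded_mult g h) n) s"
      proof (cases "ord s = n")
        case True
        then show ?thesis using s by (simp add: nth_component H.coeff_graded_mult eq_commute)
      next
        case False
        have "?t t = 0" if "t \<le> s" for t
        proof (rule ccontr)
          assume nz: "?t t \<noteq> 0"
          then have "coeff g t \<noteq> 0" "coeff h (s - t) \<noteq> 0" "ord t + ord (s - t) = n"
            by (auto split: if_splits)
          moreover from this have "t \<in> S" "s - t \<in> S" using assms H.supported_D by blast+
          ultimately show False using ord_add_ge[of t "s - t"] \<open>t \<le> s\<close> s False by simp
        qed
        then show ?thesis using False by (simp add: nth_component)
      qed
      finally show "fps_nth (sum c {..n}) s = fps_nth (component (H.graded_mult g h) n) s" .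
    qed
  qed
  finally show "to_cone (H.graded_mult g h) n = (to_cone g \<otimes>\<^bsub>tangent_cone\<^esub> to_cone h) n" ..
qed

text \<open>An element of \<open>S\<close> is at least its order, so the degree bounds the orders
  that occur. This makes \<open>to_cone h\<close> zero in almost all degrees.\<close>

lemma component_eq_0:
  assumes "degree h < n"
  shows "component h n = 0"
proof (rule fps_ext)
  fix s
  have "coeff h s = 0" if s: "s \<in> S" "ord s = n"
  proof -
    have "1 * n \<le> ns ! 0 * n" using H.e_pos by (intro mult_le_mono1) simp
    also have "\<dots> \<le> s" using H.e_mult_ord_le[OF s(1)] s(2) by simp
    finally show ?thesis using assms by (intro coeff_eq_0) simp
  qed
  then show "fps_nth (component h n) s = fps_nth 0 s" by (simp add: nth_component)
qed

lemma to_cone_one: "to_cone (1 :: 'k::field poly) = \<one>\<^bsub>tangent_cone\<^esub>"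
proof
  fix n
  have "component (1 :: 'k poly) n = (if n = 0 then 1 else 0)"
    by (rule fps_ext)
      (use ord_zero zero_in_generated_semigroup in \<open>auto simp: nth_component coeff_1 fps_one_nth\<close>)
  then show "to_cone (1 :: 'k poly) n = \<one>\<^bsub>tangent_cone\<^esub> n"
    by (simp add: to_cone_def tangent_cone_def filtration_coset_zero)
qed

lemma to_cone_zero: "to_cone (0 :: 'k::field poly) = \<zero>\<^bsub>tangent_cone\<^esub>"
proof
  fix n
  have "component (0 :: 'k poly) n = 0" by (rule fps_ext) (simp add: nth_component)
  then show "to_cone (0 :: 'k poly) n = \<zero>\<^bsub>tangent_cone\<^esub> n"
    by (simp add: to_cone_def tangent_cone_def filtration_coset_zero)
qed

lemma to_cone_closed: "to_cone h \<in> carrier tangent_cone"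
proof -
  have "{n. to_cone h n \<noteq> filtration (Suc n)} \<subseteq> {..degree h}"
    using component_eq_0[of h] filtration_coset_zero
    by (force simp: to_cone_def not_le)
  then have "finite {n. to_cone h n \<noteq> filtration (Suc n)}" by (rule finite_subset) simp
  moreover have "\<exists>x\<in>filtration n. to_cone h n = filtration (Suc n) +>\<^bsub>R\<^esub> x" for n
    unfolding to_cone_def using component_mem by blast
  ultimately show ?thesis by (simp add: tangent_cone_def)
qed

lemma to_cone_inj:
  fixes g h :: "'k::field poly"
  assumes "g \<in> H.supported" "h \<in> H.supported" "to_cone g = to_cone h"
  shows "g = h"
proof (rule poly_eqI)
  fix s
  show "coeff g s = coeff h s"
  proof (cases "s \<in> S")
    case True
    have "to_cone g (ord s) = to_cone h (ord s)" using assms(3) by simp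
    then have "\<forall>t\<in>S. ord t \<le> ord s \<longrightarrow>
        fps_nth (component g (ord s)) t = fps_nth (component h (ord s)) t"
      unfolding to_cone_def coset_eq_iff[OF component_carrier component_carrier] .
    then have "fps_nth (component g (ord s)) s = fps_nth (component h (ord s)) s"
      using True by blast
    then show ?thesis using True by (simp add: nth_component)
  next
    case False
    then have "coeff g s = 0" "coeff h s = 0" using assms(1,2) H.supported_D by blast+
    then show ?thesis by simp
  qed
qed

text \<open>The coefficient at \<open>s\<close> is taken from a representative in degree
  \<open>ord s\<close>. Only finitely many are nonzero: the order is bounded because almost all
  cosets are zero, and the excess by \<open>excess_bounded\<close>; together they bound
  \<open>s\<close>.\<close>

lemma to_cone_surj:
  fixes \<gamma> :: "nat \<Rightarrow> 'k::field fps set"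
  assumes "\<gamma> \<in> carrier tangent_cone"
  shows "\<exists>h\<in>H.supported. to_cone h = \<gamma>"
proof -
  from assms have "\<forall>n. \<exists>x. x \<in> filtration n \<and> \<gamma> n = filtration (Suc n) +>\<^bsub>R\<^esub> x"
    and fin: "finite {n. \<gamma> n \<noteq> filtration (Suc n)}"
    by (simp_all add: tangent_cone_def Bex_def)
  then obtain x where x: "\<And>n. x n \<in> filtration n" "\<And>n. \<gamma> n = filtration (Suc n) +>\<^bsub>R\<^esub> x n"
    by metis
  have x_carr: "x n \<in> carrier R" for n using x(1) filtration_carrier by blast
  obtain N where N: "\<And>n. \<gamma> n \<noteq> filtration (Suc n) \<Longrightarrow> n \<le> N"
    using fin unfolding finite_nat_set_iff_bounded_le by blast
  obtain D where D: "\<And>s. s \<in> S \<Longrightarrow> H.excess s \<le> D" using H.excess_bounded by blast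
  define c where "c s = (if s \<in> S then fps_nth (x (ord s)) s else 0)" for s
  have "c s = 0" if s: "ns ! 0 * N + D < s" for s
  proof (rule ccontr)
    assume nz: "c s \<noteq> 0"
    then have mem: "s \<in> S" by (simp add: c_def split: if_splits)
    have "\<gamma> (ord s) \<noteq> filtration (Suc (ord s))"
    proof
      assume "\<gamma> (ord s) = filtration (Suc (ord s))"
      then have eq: "filtration (Suc (ord s)) +>\<^bsub>R\<^esub> x (ord s) = filtration (Suc (ord s)) +>\<^bsub>R\<^esub> 0"
        using x(2) filtration_coset_zero by metis
      have zero_carr: "(0 :: 'k fps) \<in> carrier R" using filtration_zero filtration_carrier by blast
      have "fps_nth (x (ord s)) s = fps_nth 0 s"
        using eq mem unfolding coset_eq_iff[OF x_carr zero_carr] by blast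
      then show False using nz mem by (simp add: c_def)
    qed
    then have "ns ! 0 * ord s \<le> ns ! 0 * N" using N by simp
    moreover have "s - ns ! 0 * ord s \<le> D" using D[OF mem] by (simp add: H.excess_def)
    ultimately show False using s by linarith
  qed
  then have coeff_c: "coeff (Abs_poly c) = c" by (rule coeff_Abs_poly)
  define h where "h = Abs_poly c"
  have h: "coeff h s = c s" for s by (simp add: h_def coeff_c)
  have "h \<in> H.supported" by (simp add: H.supported_def h c_def)
  moreover have "to_cone h = \<gamma>"
  proof
    fix n
    have "fps_nth (component h n) s = fps_nth (x n) s" if s: "s \<in> S" "ord s \<le> n" for s
    proof (cases "ord s = n")
      case True
      then show ?thesis using s by (simp add: nth_component h c_def)
    next
      case False
      then have "\<not> n \<le> ord s" using s by simp
      then have "fps_nth (x n) s = 0" using filtration_D[OF x(1)] by blast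
      then show ?thesis using False by (simp add: nth_component)
    qed
    then show "to_cone h n = \<gamma> n"
      unfolding to_cone_def x(2) coset_eq_iff[OF component_carrier x_carr] by blast
  qed
  ultimately show ?thesis by blast
qed

lemma to_cone_ring_iso: "to_cone \<in> ring_iso (H.graded_ring :: 'k::field poly ring) tangent_cone"
proof (rule ring_iso_memI, unfold H.graded_ring_simps)
  show "bij_betw to_cone (H.supported :: 'k poly set) (carrier tangent_cone)"
    unfolding bij_betw_def
  proof
    show "inj_on to_cone (H.supported :: 'k poly set)" using to_cone_inj by (rule inj_onI)
    show "to_cone ` (H.supported :: 'k poly set) = carrier tangent_cone"
      using to_cone_closed to_cone_surj by blast
  qed
qed (simp_all add: to_cone_closed to_cone_mult to_cone_add to_cone_one)

theorem cohen_macaulay_assoc_graded_ring: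
  fixes M :: "'k::field fps set"
  assumes "maximalideal M R"
  shows "cohen_macaulay (assoc_graded_ring R M)"
proof -
  let ?H = "H.graded_ring :: 'k poly ring" and ?G = "tangent_cone :: (nat \<Rightarrow> 'k fps set) ring"
  \<comment> \<open>The transport result describes the target with its zero replaced by the image of
    zero; by \<open>to_cone_zero\<close> these coincide.\<close>
  have "cring (?G\<lparr>zero := to_cone \<zero>\<^bsub>?H\<^esub>\<rparr>)"
    using H.cring_graded_ring to_cone_ring_iso by (rule cring.ring_iso_imp_img_cring)
  moreover have "?G\<lparr>zero := to_cone \<zero>\<^bsub>?H\<^esub>\<rparr> = ?G"
    by (simp add: H.graded_ring_simps to_cone_zero tangent_cone_def)
  ultimately have cring: "cring ?G" by simp
  have "poly_mod_nilpotents ?G (H.proj \<circ> inv_into (carrier ?H) to_cone)"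
    using H.poly_mod_nilpotents_graded_ring cring to_cone_ring_iso by (rule poly_mod_nilpotents_iso)
  moreover have "noetherian_ring ?G"
    using H.noetherian_graded_ring cring.axioms(1)[OF cring] to_cone_ring_iso
    by (rule noetherian_ring_iso)
  ultimately show ?thesis
    unfolding assoc_graded_ring_eq[OF assms] by (rule poly_mod_nilpotents.cohen_macaulay)
qed

end


section \<open>The semigroups of the theorem\<close>

text \<open>If \<open>x\<close> or \<open>y\<close> equals \<open>k + 1\<close>, the bounds are
  restored by trading \<open>q\<close> units of \<open>x\<close> for one unit of \<open>y\<close>,
  or conversely. The second representation either has \<open>j \<ge> k\<close> and serves itself, or
  forces enough room for the trade.\<close>

lemma balanced_representation:
  fixes m q k j x y c d :: nat
  assumes q: "q = m + 1"
    and eq: "k * (m * q) + x + y * q = j * (m * q) + c + d * q"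
    and xy: "x \<le> Suc k" "y \<le> Suc k" and cd: "c \<le> j" "d \<le> j"
  shows "\<exists>l x' y'. k \<le> l \<and> x' \<le> l \<and> y' \<le> l \<and> k * (m * q) + x + y * q = l * (m * q) + x' + y' * q"
proof (cases "k \<le> j \<or> x \<le> k \<and> y \<le> k")
  case True
  then show ?thesis using eq cd by blast
next
  case False
  then have jk: "Suc j \<le> k" and xyk: "x = Suc k \<or> y = Suc k" using xy by linarith+
  have "Suc j * (m * q) \<le> k * (m * q)" "Suc d * q \<le> k * q" using jk cd by (simp_all only: mult_le_mono1)
  \<comment> \<open>From \<open>j < k\<close> follow \<open>c < k\<close> and \<open>d < k\<close>;
    comparing the two representations leaves at least one summand \<open>m * q\<close> to be
    absorbed.\<close>
  then have le: "m * q + x + y * q + q + 1 \<le> k + k * q"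
    using eq cd jk unfolding mult_Suc by linarith
  have shift: ?thesis if "x' \<le> k" "y' \<le> k" "x + y * q = x' + y' * q" for x' y'
    using that by (intro exI[of _ k] exI[of _ x'] exI[of _ y']) simp
  show ?thesis
  proof (cases "y = Suc k")
    case True
    then have "x + q \<le> k" using le by simp
    then show ?thesis using True by (intro shift[of "x + q" k]) simp_all
  next
    case False
    then have x: "x = Suc k" using xyk by simp
    have "y * q < k * q" using le x by linarith
    then have y: "Suc y \<le> k" by simp
    \<comment> \<open>Otherwise \<open>k \<le> m\<close>, so \<open>k * q \<le> m * q\<close>, and
      \<open>le\<close> would give \<open>x \<le> k\<close>.\<close>
    have "q \<le> x"
    proof (rule ccontr)
      assume "\<not> q \<le> x"
      then have "k * q \<le> m * q" using q x by (intro mult_le_mono1) simp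
      then show False using le x by linarith
    qed
    then show ?thesis using x y by (intro shift[of "x - q" "Suc y"]) (use q in simp_all)
  qed
qed

context
  fixes m q :: nat and ns :: "nat list"
  assumes m: "m \<ge> 1"
    and q: "q = m + 1"
    and ns: "ns = [m * q, m * q + 1, m * q + q, m * q + q + 1]"
begin

text \<open>With generators \<open>m * q + {0, 1} + {0, q}\<close>, the number \<open>x\<close>
  counts the parts containing the summand 1 and \<open>y\<close> those containing
  \<open>q\<close>.\<close>

lemma weight_sum_list_iff:
  "(\<exists>a. length a = length ns \<and> sum_list a = k \<and> weight ns a = s) \<longleftrightarrow>
    (\<exists>x\<le>k. \<exists>y\<le>k. s = k * (m * q) + x + y * q)" (is "?L \<longleftrightarrow> ?R")
proof -
  have weight4: "weight ns [a, b, c, d] = (a + b + c + d) * (m * q) + (b + d) + (c + d) * q" for a b c d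
    by (simp add: weight_def ns lessThan_Suc numeral_eq_Suc algebra_simps)
  show ?thesis
  proof
    assume ?L
    then obtain a where a: "length a = length ns" "sum_list a = k" "weight ns a = s" by blast
    then obtain a0 a1 a2 a3 where "a = [a0, a1, a2, a3]"
      by (auto simp: ns numeral_eq_Suc length_Suc_conv)
    then show ?R using a weight4[of a0 a1 a2 a3]
      by (intro exI[of _ "a1 + a3"] conjI exI[of _ "a2 + a3"]) auto
  next
    assume ?R
    then obtain x y where xy: "x \<le> k" "y \<le> k" "s = k * (m * q) + x + y * q" by blast
    \<comment> \<open>As many parts as possible carry both summands, so that only
      \<open>max x y\<close> of the \<open>k\<close> parts carry any.\<close>
    let ?z = "min x y"
    let ?a = "[k - max x y, x - ?z, y - ?z, ?z]"
    have sum: "k - max x y + (x - ?z) + (y - ?z) + ?z = k" "x - ?z + ?z = x" "y - ?z + ?z = y"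
      using xy by (simp_all add: min_def max_def)
    have "weight ns ?a = s" by (simp only: weight4 sum xy(3))
    moreover have "sum_list ?a = k"
      using sum(1) by (simp only: sum_list.Cons sum_list.Nil add.assoc add_0_right)
    moreover have "length ?a = length ns" by (simp add: ns)
    ultimately show ?L by blast
  qed
qed

lemma positive_generators: "positive_generators ns"
  using m q by unfold_locales (auto simp: ns)

text \<open>Taking \<open>e\<close> away from a longest factorization of \<open>s + e\<close> with
  \<open>k + 1\<close> parts gives \<open>s = k * e + x + y * q\<close>, where \<open>x\<close> and
  \<open>y\<close> may exceed \<open>k\<close> by one. \<open>balanced_representation\<close>,
  applied with a longest factorization of \<open>s\<close>, repairs this.\<close>

lemma semigroup_ord_add_first:
  assumes "s \<in> generated_semigroup ns"
  shows "semigroup_ord ns (s + ns ! 0) = Suc (semigroup_ord ns s)"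
proof (rule antisym)
  interpret positive_generators ns by (rule positive_generators)
  have e: "ns ! 0 = m * q" "ns ! 0 \<in> S" "1 \<le> ord (ns ! 0)"
    using generator_mem[of 0] ord_generator_ge[of 0] by (simp_all add: ns)
  show ge: "Suc (ord s) \<le> ord (s + ns ! 0)" using ord_add_ge[OF assms e(2)] e(3) by simp
  then obtain k where k: "ord (s + ns ! 0) = Suc k" by (metis Suc_le_D)
  obtain b where b: "length b = length ns" "weight ns b = s + ns ! 0" "sum_list b = Suc k"
    using ord_attained[OF add_in_generated_semigroup[OF assms e(2)]] k by metis
  then obtain x y where xy: "x \<le> Suc k" "y \<le> Suc k" "s + ns ! 0 = Suc k * (m * q) + x + y * q"
    using weight_sum_list_iff[of "Suc k" "s + ns ! 0"] by blast
  then have s: "s = k * (m * q) + x + y * q" by (simp add: e(1))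
  obtain a where a: "length a = length ns" "weight ns a = s" "sum_list a = ord s"
    using assms by (rule ord_attained)
  then obtain c d where cd: "c \<le> ord s" "d \<le> ord s" "s = ord s * (m * q) + c + d * q"
    using weight_sum_list_iff[of "ord s" s] by blast
  obtain l x' y' where l: "k \<le> l" "x' \<le> l" "y' \<le> l" "s = l * (m * q) + x' + y' * q"
    using balanced_representation[OF q _ xy(1,2) cd(1,2)] s cd(3) by metis
  then obtain a' where "length a' = length ns" "sum_list a' = l" "weight ns a' = s"
    using weight_sum_list_iff[of l s] by blast
  then have "l \<le> ord s" using sum_list_le_ord[of a'] by simp
  then show "ord (s + ns ! 0) \<le> Suc (ord s)" using k l(1) by simp
qed

lemma order_raising_generators: "order_raising_generators ns"
proof (intro order_raising_generators.intro positive_generators order_raising_generators_axioms.intro)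
  show "ns \<noteq> []" "\<forall>k\<in>set ns. ns ! 0 \<le> k" by (simp_all add: ns)
qed (rule semigroup_ord_add_first)

end

theorem corollary4p8:
  fixes m n1 n2 n3 n4 :: nat
    and R :: "'k::field fps ring"
    and M :: "'k fps set"
  assumes "m \<ge> 2"
    and "n1 = m * (m + 1)"
    and "n2 = m * (m + 1) + 1"
    and "n3 = (m + 1)^2"
    and "n4 = (m + 1)^2 + 1"
    and "R = power_series_ring [n1, n2, n3, n4]"
    and "maximalideal M R"
  shows "cohen_macaulay (assoc_graded_ring R M)"
proof -
  \<comment> \<open>With \<open>q = m + 1\<close>, the square \<open>q^2\<close> equals
    \<open>m * q + q\<close>.\<close>
  have "[n1, n2, n3, n4] =
      [m * (m + 1), m * (m + 1) + 1, m * (m + 1) + (m + 1), m * (m + 1) + (m + 1) + 1]"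
    using assms(2-5) by (simp add: power2_eq_square)
  then interpret order_raising_generators "[n1, n2, n3, n4]"
    using assms(1) by (intro order_raising_generators[of m "m + 1"]) simp_all
  show ?thesis
    unfolding assms(6) using assms(7) unfolding assms(6) by (rule cohen_macaulay_assoc_graded_ring)
qed

end
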